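(* Let $\mathcal{G}$ be a minor-closed class of boundary coloured ribbon graphs (closed under deletion and contraction). Then there is a unique map $U:\mathcal{G}\to\mathbb{Z}[\beta,\gamma,a_{\mathrm{b}}^{1/2},a_{\mathrm{olc}},a_{\mathrm{olh}}^{1/2},b_{\mathrm{b}}^{1/2},b_{\mathrm{olc}},b_{\mathrm{olh}}^{1/2}]$ such that $U(\mathbb{G})=a_iU(\mathbb{G}\backslash e)+b_jU(\mathbb{G}/e)$ whenever $e$ is an edge of $\mathbb{G}$ of type $(i,j)$, and $U(\mathbb{G})=\beta^m\gamma^v$ whenever $\mathbb{G}$ is edgeless with $v$ vertices and $m$ boundary colour classes, where $a_{\mathrm{nl}}=a_{\mathrm{b}}^{1/2}a_{\mathrm{olh}}^{1/2}$ and $b_{\mathrm{nl}}=b_{\mathrm{b}}^{1/2}b_{\mathrm{olh}}^{1/2}$. Moreover, $$U(\mathbb{G})=\beta^{k(\mathbb{G}^*/\mathcal{B})}\gamma^{v(\mathbb{G})-\rho(\mathbb{G})}b_{\mathrm{b}}^{\rho(\mathbb{G})}a_{\mathrm{olc}}^{r_3(\mathbb{G})}a_{\mathrm{olh}}^{r_4(\mathbb{G})}\,T_s\Big(\mathbb{G};\frac{\gamma a_{\mathrm{b}}}{b_{\mathrm{b}}},\frac{\beta\gamma b_{\mathrm{olc}}}{a_{\mathrm{olc}}},\frac{\gamma b_{\mathrm{olh}}}{a_{\mathrm{olh}}}\Big).$$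
   Context: A ribbon graph $\mathbb{G}=(V,E)$ is a surface with boundary represented as a union of two finite sets of closed discs, vertices and edges, meeting in disjoint line segments, each on the boundary of exactly one vertex and one edge, each edge containing exactly two such segments; $F(\mathbb{G})$ is its set of boundary components. A loop is an edge meeting one vertex; non-orientable if its union with its vertex is a Möbius band, orientable otherwise. Deletion $\mathbb{G}\backslash e$ removes $e$; contraction $\mathbb{G}/e$ glues a disc (new vertex) along each boundary component of $e\cup u\cup v$ ($u,v$ the ends of $e$) and removes $e,u,v$; contraction leaves boundary components unchanged. $e^c=E\setminus\{e\}$. A boundary coloured ribbon graph is a ribbon graph with a partition $\mathcal{B}$ of $F(\mathbb{G})$ into boundary colour classes (up to equivalences preserving it). Contraction leaves boundary classes unchanged. Deletion of $e$: if $e$ meets distinct boundary components $a,b$ which merge into $r$, their classes merge into the single class $([a]\cup[b]\cup\{r\})\setminus\{a,b\}$; if $e$ meets one boundary component $a$ and one component $r$ results, $r$ replaces $a$ in its class; if two components $r,s$ result, both replace $a$ in its class; other components keep their classes. Edge types: $\mathrm{b}$ = one edge joining two distinct vertices; $\mathrm{olc}$ = one vertex with an orientable loop whose two boundary components are in different boundary colour classes; $\mathrm{olh}$ = one vertex with an orientable loop whose two boundary components are in the same class; $\mathrm{nl}$ = one vertex with a non-orientable loop. Edge $e$ is of type $(i,j)$ if after removing isolated vertices $\mathbb{G}/e^c=i$ and $\mathbb{G}\backslash e^c=j$. Parameters: $v(\mathbb{G})=|V|$; $b(A)$ = number of boundary components of ribbon subgraph $(V,A)$; $\rho(A)=\frac12(|A|+|V|-b(A))$,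 $\rho(\mathbb{G})=\rho(E)$. $\mathbb{G}^*/\mathcal{B}$ is the graph whose vertices are the boundary colour classes, with one edge for each edge $e$ of $\mathbb{G}$ joining the classes of the boundary components touching $e$; $k(\cdot)$ is number of components and $r_H(A)$ the rank of the spanning subgraph with edge set $A$. $r_3(A)=r_{\mathbb{G}^*/\mathcal{B}}(E)-r_{\mathbb{G}^*/\mathcal{B}}(E\setminus A)$, $r_4(A)=|A|+r_{\mathbb{G}^*/\mathcal{B}}(E\setminus A)-r_{\mathbb{G}^*/\mathcal{B}}(E)-\rho(A)$, $r_i(\mathbb{G})=r_i(E)$. The Tutte polynomial of a boundary coloured ribbon graph is $T_s(\mathbb{G};x,y,z)=\sum_{A\subseteq E}x^{\rho(E)-\rho(A)}y^{r_3(A)}z^{r_4(A)}$. *)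

theory Defs
  imports Complex_Main "HOL-Library.Poly_Mapping" "HOL-Library.Disjoint_Sets" "HOL-Library.FuncSet"
begin

text \<open>
  Ribbon graphs are encoded combinatorially. The boundary circle of every vertex disc carries
  finitely many marked points, which cut it alternately into \<^emph>\<open>arcs\<close> and \<^emph>\<open>segments\<close>; \<open>arc p\<close> and
  \<open>seg p\<close> are the other ends of the arc and of the segment at \<open>p\<close>. An edge disc meets the vertices
  in exactly two segments and is given by the set of its four corner points; \<open>side p\<close> is the other
  end of the free side of the edge disc at the corner \<open>p\<close>.

  Segments to which no edge is attached are allowed; they are just part of the free boundary and
  are ignored by the notion of equivalence below. In particular an isolated vertex is a circle
  all of whose segments are unattached. Thanks to them, deletion and contraction keep the
  set of marked points, and an edge keeps its identity in every minor.
\<close>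

definition conn_classes :: "'a set \<Rightarrow> 'a rel \<Rightarrow> 'a set set" where
  "conn_classes S R = S // ((R \<union> R\<inverse>) \<inter> S \<times> S)\<^sup>*"

record 'a ribbon_graph =
  points :: "'a set"
  arc :: "'a \<Rightarrow> 'a"
  seg :: "'a \<Rightarrow> 'a"
  side :: "'a \<Rightarrow> 'a"
  edges :: "'a set set"

definition fpf_involution_on :: "'a set \<Rightarrow> ('a \<Rightarrow> 'a) \<Rightarrow> bool" where
  "fpf_involution_on S f \<longleftrightarrow> (\<forall>p\<in>S. f p \<in> S \<and> f p \<noteq> p \<and> f (f p) = p)"

text \<open>The last condition says that \<open>seg\<close> and \<open>side\<close> together make the four corners of an edge into
  a 4-cycle, the boundary of the edge disc.\<close>

definition ribbon_graph :: "('a, 'z) ribbon_graph_scheme \<Rightarrow> bool" where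
  "ribbon_graph G \<longleftrightarrow>
     finite (points G) \<and>
     fpf_involution_on (points G) (arc G) \<and>
     fpf_involution_on (points G) (seg G) \<and>
     disjoint (edges G) \<and>
     (\<forall>e\<in>edges G. e \<subseteq> points G \<and> card e = 4 \<and>
        fpf_involution_on e (seg G) \<and> fpf_involution_on e (side G) \<and>
        (\<forall>p\<in>e. side G p \<noteq> seg G p))"

definition verts :: "('a, 'z) ribbon_graph_scheme \<Rightarrow> 'a set set" where
  "verts G = conn_classes (points G) ({(p, arc G p) | p. True} \<union> {(p, seg G p) | p. True})"

text \<open>The boundary of the surface runs along the arcs, the free sides of the edges and the
  unattached segments.\<close>

definition bdry :: "('a, 'z) ribbon_graph_scheme \<Rightarrow> 'a set set" where
  "bdry G = conn_classes (points G)
     ({(p, arc G p) | p. True} \<union> {(p, side G p) | p. p \<in> \<Union>(edges G)} \<union>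
      {(p, seg G p) | p. p \<notin> \<Union>(edges G)})"

text \<open>Orientability of the surface: the points can be divided into initial and final ends such that
  each arc, segment and edge side runs from one to the other. For one
  vertex with one loop this distinguishes the annulus from the Moebius band.\<close>

definition orientable :: "('a, 'z) ribbon_graph_scheme \<Rightarrow> bool" where
  "orientable G \<longleftrightarrow> (\<exists>S. \<forall>p\<in>points G.
     (arc G p \<in> S \<longleftrightarrow> p \<notin> S) \<and> (seg G p \<in> S \<longleftrightarrow> p \<notin> S) \<and>
     (p \<in> \<Union>(edges G) \<longrightarrow> (side G p \<in> S \<longleftrightarrow> p \<notin> S)))"

record 'a bcrg = "'a ribbon_graph" +
  colours :: "'a set set set"

definition bcrg :: "'a bcrg \<Rightarrow> bool" where
  "bcrg G \<longleftrightarrow> ribbon_graph G \<and> partition_on (bdry G) (colours G)"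

text \<open>In \<open>delete\<close>, \<open>T\<close> are the boundary components meeting \<open>e\<close> before, and \<open>R\<close> those resulting from
  them after the deletion. The new colour class is \<open>([a] \<union> [b] \<union> {r}) - {a, b}\<close> if \<open>T = {a, b}\<close> and
  \<open>R = {r}\<close>, and it is \<open>[a]\<close> with \<open>a\<close> replaced by the members of \<open>R\<close> if \<open>T = {a}\<close>.\<close>

definition delete :: "'a bcrg \<Rightarrow> 'a set \<Rightarrow> 'a bcrg" where
  "delete G e =
     (let G' = G\<lparr>edges := edges G - {e}\<rparr>;
          T = {a \<in> bdry G. a \<inter> e \<noteq> {}};
          R = {r \<in> bdry G'. r \<inter> e \<noteq> {}}
      in G'\<lparr>colours := {C \<in> colours G. C \<inter> T = {}} \<union>
                        {(\<Union>{C \<in> colours G. C \<inter> T \<noteq> {}} - T) \<union> R}\<rparr>)"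

text \<open>The boundary components of the union of \<open>e\<close> with its end vertices become vertex boundaries:
  the two segments of \<open>e\<close> are replaced by its two free sides. The set \<open>bdry\<close> does not change.\<close>

definition contract :: "'a bcrg \<Rightarrow> 'a set \<Rightarrow> 'a bcrg" where
  "contract G e = G\<lparr>seg := (\<lambda>p. if p \<in> e then side G p else seg G p), edges := edges G - {e}\<rparr>"

text \<open>Deletion and contraction of a finite set of edges, one after the other; the order is
  immaterial.\<close>

definition enumeration :: "'b set \<Rightarrow> 'b list" where
  "enumeration A = (SOME xs. distinct xs \<and> set xs = A)"

definition delete_all :: "'a bcrg \<Rightarrow> 'a set set \<Rightarrow> 'a bcrg" where
  "delete_all G A = foldl delete G (enumeration A)"

definition contract_all :: "'a bcrg \<Rightarrow> 'a set set \<Rightarrow> 'a bcrg" where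
  "contract_all G A = foldl contract G (enumeration A)"

definition remove_isolated :: "'a bcrg \<Rightarrow> 'a bcrg" where
  "remove_isolated G =
     (let P = \<Union>{v \<in> verts G. v \<inter> \<Union>(edges G) \<noteq> {}}
      in G\<lparr>points := P, colours := (\<lambda>C. {a \<in> C. a \<subseteq> P}) ` colours G - {{}}\<rparr>)"

text \<open>The connected pieces of the vertex boundaries that remain free of edges: circles for isolated
  vertices, and otherwise arcs joining two edge corners.\<close>

definition free_arcs :: "('a, 'z) ribbon_graph_scheme \<Rightarrow> 'a set set" where
  "free_arcs G = conn_classes (points G)
     ({(p, arc G p) | p. True} \<union> {(p, seg G p) | p. p \<notin> \<Union>(edges G)})"

definition same_colour :: "'a bcrg \<Rightarrow> 'a set \<Rightarrow> 'a set \<Rightarrow> bool" where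
  "same_colour G s t \<longleftrightarrow> (\<exists>C\<in>colours G. s \<subseteq> \<Union>C \<and> t \<subseteq> \<Union>C)"

text \<open>Equivalence, that is, homeomorphism of the underlying surfaces taking vertices to vertices,
  edges to edges and boundary colour classes to boundary colour classes. It is given by a
  bijection \<open>h\<close> of the edge corners and a compatible bijection \<open>k\<close> of the free arcs; every boundary
  component contains a free arc.\<close>

definition equivalent :: "'a bcrg \<Rightarrow> 'a bcrg \<Rightarrow> bool" where
  "equivalent G H \<longleftrightarrow> (\<exists>h k.
     bij_betw h (\<Union>(edges G)) (\<Union>(edges H)) \<and>
     bij_betw k (free_arcs G) (free_arcs H) \<and>
     (\<forall>p\<in>\<Union>(edges G). h (seg G p) = seg H (h p) \<and> h (side G p) = side H (h p) \<and>
        (\<forall>s\<in>free_arcs G. p \<in> s \<longleftrightarrow> h p \<in> k s)) \<and>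
     (\<forall>s\<in>free_arcs G. \<forall>t\<in>free_arcs G. same_colour G s t \<longleftrightarrow> same_colour H (k s) (k t)))"

text \<open>As boundary coloured ribbon graphs are considered up to equivalence, a class of them
  is a set of representatives that is closed under equivalence.\<close>

definition minor_closed :: "'a bcrg set \<Rightarrow> bool" where
  "minor_closed \<G> \<longleftrightarrow>
     (\<forall>G\<in>\<G>. bcrg G) \<and>
     (\<forall>G\<in>\<G>. \<forall>H. bcrg H \<and> equivalent G H \<longrightarrow> H \<in> \<G>) \<and>
     (\<forall>G\<in>\<G>. \<forall>e\<in>edges G. delete G e \<in> \<G> \<and> contract G e \<in> \<G>)"

datatype etype = Type_b | Type_olc | Type_olh | Type_nl

fun is_single_edge :: "'a bcrg \<Rightarrow> etype \<Rightarrow> bool" where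
  "is_single_edge G Type_b \<longleftrightarrow> card (edges G) = 1 \<and> card (verts G) = 2"
| "is_single_edge G Type_olc \<longleftrightarrow> card (edges G) = 1 \<and> card (verts G) = 1 \<and> orientable G \<and>
     (\<exists>f g. bdry G = {f, g} \<and> f \<noteq> g \<and> \<not> (\<exists>C\<in>colours G. f \<in> C \<and> g \<in> C))"
| "is_single_edge G Type_olh \<longleftrightarrow> card (edges G) = 1 \<and> card (verts G) = 1 \<and> orientable G \<and>
     (\<exists>f g. bdry G = {f, g} \<and> f \<noteq> g \<and> (\<exists>C\<in>colours G. f \<in> C \<and> g \<in> C))"
| "is_single_edge G Type_nl \<longleftrightarrow> card (edges G) = 1 \<and> card (verts G) = 1 \<and> \<not> orientable G"

text \<open>No incidence condition is needed for \<open>Type_b\<close>: the predicate is only used after the removal of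
  isolated vertices, so the edge meets both vertices.\<close>

definition edge_type :: "'a bcrg \<Rightarrow> 'a set \<Rightarrow> etype \<Rightarrow> etype \<Rightarrow> bool" where
  "edge_type G e i j \<longleftrightarrow>
     is_single_edge (remove_isolated (contract_all G (edges G - {e}))) i \<and>
     is_single_edge (remove_isolated (delete_all G (edges G - {e}))) j"

record ('v, 'e) multigraph =
  mverts :: "'v set"
  medges :: "'e set"
  mends :: "'e \<Rightarrow> 'v set"

definition mcomponents :: "('v, 'e) multigraph \<Rightarrow> 'e set \<Rightarrow> 'v set set" where
  "mcomponents H A = conn_classes (mverts H) {(u, w). \<exists>e\<in>A. u \<in> mends H e \<and> w \<in> mends H e}"

definition ncomp :: "('v, 'e) multigraph \<Rightarrow> nat" where
  "ncomp H = card (mcomponents H (medges H))"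

definition mrank :: "('v, 'e) multigraph \<Rightarrow> 'e set \<Rightarrow> rat" where
  "mrank H A = of_nat (card (mverts H)) - of_nat (card (mcomponents H A))"

definition colour_graph :: "'a bcrg \<Rightarrow> ('a set set, 'a set) multigraph" where
  "colour_graph G = \<lparr>mverts = colours G, medges = edges G,
     mends = (\<lambda>e. {C \<in> colours G. \<exists>f\<in>C. f \<inter> e \<noteq> {}})\<rparr>"

definition rho :: "'a bcrg \<Rightarrow> 'a set set \<Rightarrow> rat" where
  "rho G A = (of_nat (card A) + of_nat (card (verts G)) - of_nat (card (bdry (G\<lparr>edges := A\<rparr>)))) / 2"

definition r3 :: "'a bcrg \<Rightarrow> 'a set set \<Rightarrow> rat" where
  "r3 G A = mrank (colour_graph G) (edges G) - mrank (colour_graph G) (edges G - A)"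

definition r4 :: "'a bcrg \<Rightarrow> 'a set set \<Rightarrow> rat" where
  "r4 G A = of_nat (card A) + mrank (colour_graph G) (edges G - A)
     - mrank (colour_graph G) (edges G) - rho G A"

text \<open>All polynomials live in the ring of integer combinations of monomials with rational exponents
  in eight indeterminates, where fractional and negative powers of monomials are available.
  A monomial is represented by its exponent vector, so products of monomials are sums of exponent
  vectors, and \<open>mpow q m\<close> is the \<open>q\<close>-th power of the monomial \<open>m\<close>.\<close>

datatype indet = Beta | Gamma | A_b | A_olc | A_olh | B_b | B_olc | B_olh

type_synonym monomial = "indet \<Rightarrow>\<^sub>0 rat"

type_synonym gpoly = "monomial \<Rightarrow>\<^sub>0 int"

definition mpow :: "rat \<Rightarrow> monomial \<Rightarrow> monomial" where
  "mpow q m = Poly_Mapping.map ((*) q) m"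

definition of_monomial :: "monomial \<Rightarrow> gpoly" where
  "of_monomial m = Poly_Mapping.single m 1"

definition var :: "indet \<Rightarrow> monomial" where
  "var v = Poly_Mapping.single v 1"

text \<open>\<open>vpow v q\<close> is \<open>v\<close> to the power \<open>q\<close>.\<close>

definition vpow :: "indet \<Rightarrow> rat \<Rightarrow> gpoly" where
  "vpow v q = of_monomial (mpow q (var v))"

text \<open>The polynomial ring over the integers in \<open>Beta\<close>, \<open>Gamma\<close>, \<open>A_olc\<close>, \<open>B_olc\<close> and the square
  roots of \<open>A_b\<close>, \<open>A_olh\<close>, \<open>B_b\<close>, \<open>B_olh\<close>.\<close>

definition coeff_ring :: "gpoly set" where
  "coeff_ring = {p. \<forall>m\<in>Poly_Mapping.keys p. \<forall>v. 0 \<le> Poly_Mapping.lookup m v \<and>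
     (if v \<in> {Beta, Gamma, A_olc, B_olc} then Poly_Mapping.lookup m v \<in> \<int>
      else 2 * Poly_Mapping.lookup m v \<in> \<int>)}"

fun a_coeff :: "etype \<Rightarrow> gpoly" where
  "a_coeff Type_b = vpow A_b 1"
| "a_coeff Type_olc = vpow A_olc 1"
| "a_coeff Type_olh = vpow A_olh 1"
| "a_coeff Type_nl = vpow A_b (1/2) * vpow A_olh (1/2)"

fun b_coeff :: "etype \<Rightarrow> gpoly" where
  "b_coeff Type_b = vpow B_b 1"
| "b_coeff Type_olc = vpow B_olc 1"
| "b_coeff Type_olh = vpow B_olh 1"
| "b_coeff Type_nl = vpow B_b (1/2) * vpow B_olh (1/2)"

text \<open>The exponents are half-integers in general, so the arguments are monomials.\<close>

definition tutte_s :: "'a bcrg \<Rightarrow> monomial \<Rightarrow> monomial \<Rightarrow> monomial \<Rightarrow> gpoly" where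
  "tutte_s G x y z = (\<Sum>A\<in>Pow (edges G).
     of_monomial (mpow (rho G (edges G) - rho G A) x) *
     of_monomial (mpow (r3 G A) y) * of_monomial (mpow (r4 G A) z))"

text \<open>Maps on a class of boundary coloured ribbon graphs respect equivalence. Requiring
  \<open>U \<in> \<G> \<rightarrow>\<^sub>E coeff_ring\<close> rather than \<open>U \<in> \<G> \<rightarrow> coeff_ring\<close> fixes the irrelevant values outside \<open>\<G>\<close>.\<close>

definition deletion_contraction_map :: "'a bcrg set \<Rightarrow> ('a bcrg \<Rightarrow> gpoly) \<Rightarrow> bool" where
  "deletion_contraction_map \<G> U \<longleftrightarrow>
     U \<in> \<G> \<rightarrow>\<^sub>E coeff_ring \<and>
     (\<forall>G\<in>\<G>. \<forall>H\<in>\<G>. equivalent G H \<longrightarrow> U G = U H) \<and>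
     (\<forall>G\<in>\<G>. \<forall>e\<in>edges G. \<forall>i j. edge_type G e i j \<longrightarrow>
        U G = a_coeff i * U (delete G e) + b_coeff j * U (contract G e)) \<and>
     (\<forall>G\<in>\<G>. edges G = {} \<longrightarrow>
        U G = vpow Beta 1 ^ card (colours G) * vpow Gamma 1 ^ card (verts G))"

end

theory Submission
  imports Defs
begin

text \<open>
  Write \<open>b(A)\<close> for the number of boundary components of the spanning ribbon subgraph with edge set
  \<open>A\<close> and \<open>c(B)\<close> for the number of components of the colour graph with edge set \<open>B\<close>.
  Expanding the right-hand side of the formula gives a state sum over \<open>A\<close>: contracting \<open>A\<close> and
  deleting the other edges leaves \<open>b(A)\<close> vertices and \<open>c(E - A)\<close> colour classes, so the term is
  \<open>\<beta>\<close> to the power \<open>c(E - A)\<close> times \<open>\<gamma>\<close> to the power \<open>b(A)\<close> times a monomial in the coefficients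
  whose exponents depend only on \<open>b\<close> and \<open>c\<close>. Deletion keeps \<open>b\<close> and turns \<open>c(B)\<close> into
  \<open>c(B \<union> {e})\<close>, while contraction turns \<open>b(A)\<close> into \<open>b(A \<union> {e})\<close> and keeps \<open>c\<close>. Splitting the sum
  according to \<open>e \<in> A\<close> therefore yields the recursion, provided that the type \<open>(i, j)\<close> of \<open>e\<close> records
  the increments of \<open>b\<close> and \<open>c\<close> at \<open>e\<close>. This is a statement about a single ribbon edge: the vertex
  boundary without the two segments of \<open>e\<close> joins the four corners of \<open>e\<close> in pairs, and the three
  possible pairings (along the segments, along the sides, or diagonally) correspond to \<open>b\<close>, \<open>ol\<close>
  and \<open>nl\<close>.
\<close>

section \<open>Classes of a generated equivalence relation\<close>

text \<open>The relation behind \<open>conn_classes\<close>. Being a reflexive transitive closure,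
  it relates every element of the type to itself, also outside \<open>S\<close>; hence the rules
  below ask for membership in \<open>S\<close> where a path has to stay inside it.\<close>

definition conn :: "'a set \<Rightarrow> 'a rel \<Rightarrow> 'a rel" where
  "conn S R = ((R \<union> R\<inverse>) \<inter> S \<times> S)\<^sup>*"

lemma conn_classes_conn: "conn_classes S R = S // conn S R"
  by (simp add: conn_classes_def conn_def)

lemma conn_refl [simp]: "(x, x) \<in> conn S R"
  by (simp add: conn_def)

lemma conn_sym: "(x, y) \<in> conn S R \<Longrightarrow> (y, x) \<in> conn S R"
proof -
  have "sym ((R \<union> R\<inverse>) \<inter> S \<times> S)" by (auto simp: sym_def)
  then show "(x, y) \<in> conn S R \<Longrightarrow> (y, x) \<in> conn S R"
    unfolding conn_def by (meson sym_rtrancl symD)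
qed

lemma conn_trans: "(x, y) \<in> conn S R \<Longrightarrow> (y, z) \<in> conn S R \<Longrightarrow> (x, z) \<in> conn S R"
  unfolding conn_def by (rule rtrancl_trans)

lemma conn_step: "(x, y) \<in> R \<Longrightarrow> x \<in> S \<Longrightarrow> y \<in> S \<Longrightarrow> (x, y) \<in> conn S R"
  unfolding conn_def by blast

text \<open>Induction along a path whose steps may follow \<open>R\<close> in either direction. It
  supplies membership in \<open>S\<close> for both ends of each step, which plain
  \<open>rtrancl_induct\<close> hides in the restricted relation.\<close>

lemma conn_induct [consumes 2, case_names refl step]:
  assumes "(x, y) \<in> conn S R" "x \<in> S" "P x"
    and "\<And>y z. (x, y) \<in> conn S R \<Longrightarrow> P y \<Longrightarrow> y \<in> S \<Longrightarrow> z \<in> S \<Longrightarrow> (y, z) \<in> R \<or> (z, y) \<in> R \<Longrightarrow> P z"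
  shows "P y"
proof -
  have "(x, y) \<in> ((R \<union> R\<inverse>) \<inter> S \<times> S)\<^sup>*" using assms(1) by (simp add: conn_def)
  then show ?thesis
  proof (induction rule: rtrancl_induct)
    case base
    show ?case using assms(3) .
  next
    case (step y z)
    then show ?case using assms(4)[of y z] by (auto simp: conn_def)
  qed
qed

lemma conn_in:
  assumes "(x, y) \<in> conn S R" "x \<in> S"
  shows "y \<in> S"
  using assms by (induction rule: conn_induct) (auto simp: assms(2))

lemma conn_extend:
  assumes "(x, y) \<in> conn S R" "y \<in> S" "z \<in> S" "(y, z) \<in> R \<or> (z, y) \<in> R"
  shows "(x, z) \<in> conn S R"
  using assms conn_trans[OF assms(1)] conn_step[of y z R S] conn_sym[OF conn_step[of z y R S]] by blast

lemma conn_subset: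
  assumes "(x, y) \<in> conn S R" "x \<in> S"
    and "\<And>x y. (x, y) \<in> R \<Longrightarrow> x \<in> S \<Longrightarrow> y \<in> S \<Longrightarrow> (x, y) \<in> conn S Q"
  shows "(x, y) \<in> conn S Q"
  using assms(1,2)
proof (induction rule: conn_induct)
  case (step y z)
  then show ?case
    using conn_trans[OF step.IH] assms(3)[of y z] conn_sym[OF assms(3)[of z y]] by blast
qed simp

lemma conn_mono: "(x, y) \<in> conn S R \<Longrightarrow> R \<subseteq> Q \<Longrightarrow> (x, y) \<in> conn S Q"
proof -
  assume "(x, y) \<in> conn S R" "R \<subseteq> Q"
  moreover have "(R \<union> R\<inverse>) \<inter> S \<times> S \<subseteq> (Q \<union> Q\<inverse>) \<inter> S \<times> S" using \<open>R \<subseteq> Q\<close> by blast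
  ultimately show ?thesis unfolding conn_def by (metis rtrancl_mono subsetD)
qed

lemma conn_classes_I: "x \<in> S \<Longrightarrow> conn S R `` {x} \<in> conn_classes S R"
  by (simp add: conn_classes_conn quotientI)

lemma conn_classes_E:
  assumes "C \<in> conn_classes S R"
  obtains x where "x \<in> S" "C = conn S R `` {x}"
  using assms by (auto simp: conn_classes_conn elim: quotientE)

lemma conn_class_eq:
  assumes "(x, y) \<in> conn S R"
  shows "conn S R `` {x} = conn S R `` {y}"
proof (rule set_eqI)
  fix z
  show "z \<in> conn S R `` {x} \<longleftrightarrow> z \<in> conn S R `` {y}"
    using conn_trans[OF assms, of z] conn_trans[OF conn_sym[OF assms], of z] by auto
qed

lemma conn_class_eq_iff: "conn S R `` {x} = conn S R `` {y} \<longleftrightarrow> (x, y) \<in> conn S R"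
  by (metis Image_singleton_iff conn_class_eq conn_refl)

lemma conn_classes_mem:
  assumes "C \<in> conn_classes S R" "x \<in> C"
  shows "C = conn S R `` {x}" "x \<in> S"
proof -
  obtain z where z: "z \<in> S" "C = conn S R `` {z}" using assms(1) by (elim conn_classes_E)
  then have "(z, x) \<in> conn S R" using assms(2) by simp
  from conn_class_eq[OF this] conn_in[OF this z(1)] show "C = conn S R `` {x}" "x \<in> S"
    unfolding z(2) .
qed

lemma partition_conn_classes: "partition_on S (conn_classes S R)"
proof (rule partition_onI)
  have "x \<in> \<Union>(conn_classes S R)" if "x \<in> S" for x
    by (rule UnionI[OF conn_classes_I[OF that]]) simp
  moreover have "\<Union>(conn_classes S R) \<subseteq> S"
    using conn_classes_mem(2)[of _ S R] by blast
  ultimately show "\<Union>(conn_classes S R) = S" by blast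
next
  show "{} \<notin> conn_classes S R"
  proof
    assume "{} \<in> conn_classes S R"
    then obtain x where "{} = conn S R `` {x}" by (elim conn_classes_E)
    then show False using conn_refl[of x S R] by blast
  qed
next
  fix p q assume "p \<in> conn_classes S R" "q \<in> conn_classes S R" "p \<noteq> q"
  then have "x \<notin> q" if "x \<in> p" for x
    using that conn_classes_mem(1)[of p S R x] conn_classes_mem(1)[of q S R x] by blast
  then show "disjnt p q" by (auto simp: disjnt_def)
qed

lemma Union_conn_classes [simp]: "\<Union>(conn_classes S R) = S"
  using partition_conn_classes partition_onD1 by metis

lemma finite_conn_classes: "finite S \<Longrightarrow> finite (conn_classes S R)"
  by (metis finite_UnionD Union_conn_classes)

lemma conn_classes_closed:
  assumes "C \<in> conn_classes S R" "x \<in> C" "(x, y) \<in> conn S R"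
  shows "y \<in> C"
  using conn_classes_mem[OF assms(1,2)] assms(3) by simp

lemma conn_classes_eqI:
  assumes "\<And>x y. (x, y) \<in> R \<Longrightarrow> x \<in> S \<Longrightarrow> y \<in> S \<Longrightarrow> (x, y) \<in> conn S Q"
    and "\<And>x y. (x, y) \<in> Q \<Longrightarrow> x \<in> S \<Longrightarrow> y \<in> S \<Longrightarrow> (x, y) \<in> conn S R"
  shows "conn_classes S R = conn_classes S Q"
proof -
  have "conn S R `` {x} = conn S Q `` {x}" if "x \<in> S" for x
  proof (intro equalityI subsetI)
    fix y assume "y \<in> conn S R `` {x}"
    then show "y \<in> conn S Q `` {x}" using conn_subset[OF _ that assms(1)] by auto
  next
    fix y assume "y \<in> conn S Q `` {x}"
    then show "y \<in> conn S R `` {x}" using conn_subset[OF _ that assms(2)] by auto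
  qed
  then show ?thesis
    unfolding conn_classes_conn quotient_def by (metis (no_types, lifting) SUP_cong)
qed

section \<open>Comparing the numbers of classes of two relations\<close>

text \<open>Taking images under \<open>f\<close> is a bijection between the two sets of classes: by
  \<open>iff\<close> it sends the class of \<open>x\<close> onto the class of \<open>f x\<close>,
  and two classes have the same image only if their representatives are connected.\<close>

lemma card_conn_classes_eq:
  assumes "f ` S = T"
    and iff: "\<And>x y. x \<in> S \<Longrightarrow> y \<in> S \<Longrightarrow> (x, y) \<in> conn S R \<longleftrightarrow> (f x, f y) \<in> conn T Q"
  shows "card (conn_classes S R) = card (conn_classes T Q)"
proof -
  have im: "f ` (conn S R `` {x}) = conn T Q `` {f x}" if "x \<in> S" for x
  proof
    show "f ` (conn S R `` {x}) \<subseteq> conn T Q `` {f x}"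
    proof
      fix t assume "t \<in> f ` (conn S R `` {x})"
      then obtain y where y: "(x, y) \<in> conn S R" "t = f y" by blast
      then show "t \<in> conn T Q `` {f x}" using iff[OF that conn_in[OF y(1) that]] by simp
    qed
  next
    show "conn T Q `` {f x} \<subseteq> f ` (conn S R `` {x})"
    proof
      fix t assume "t \<in> conn T Q `` {f x}"
      then have t: "(f x, t) \<in> conn T Q" by simp
      have "f x \<in> T" using assms(1) that by blast
      from conn_in[OF t this] obtain y where y: "y \<in> S" "t = f y" using assms(1) by blast
      then have "(x, y) \<in> conn S R" using iff[OF that y(1)] t by simp
      then show "t \<in> f ` (conn S R `` {x})" using y(2) by blast
    qed
  qed
  have "bij_betw ((`) f) (conn_classes S R) (conn_classes T Q)"
  proof (rule bij_betwI')
    fix C D assume "C \<in> conn_classes S R" "D \<in> conn_classes S R"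
    then obtain x y where xy: "x \<in> S" "C = conn S R `` {x}" "y \<in> S" "D = conn S R `` {y}"
      by (auto elim!: conn_classes_E)
    show "(f ` C = f ` D) = (C = D)"
      unfolding xy(2,4) im[OF xy(1)] im[OF xy(3)] conn_class_eq_iff using iff xy by simp
  next
    fix C assume "C \<in> conn_classes S R"
    then obtain x where x: "x \<in> S" "C = conn S R `` {x}" by (auto elim!: conn_classes_E)
    then show "f ` C \<in> conn_classes T Q" using im assms(1) by (auto intro: conn_classes_I)
  next
    fix D assume "D \<in> conn_classes T Q"
    then obtain t where t: "t \<in> T" "D = conn T Q `` {t}" by (auto elim!: conn_classes_E)
    then obtain x where "x \<in> S" "t = f x" using assms(1) by auto
    then show "\<exists>C\<in>conn_classes S R. D = f ` C" using im t conn_classes_I by metis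
  qed
  then show ?thesis by (rule bij_betw_same_card)
qed

text \<open>The tool for passing from points to coarser objects such as colours or free arcs. A path
  in \<open>T\<close> lifts to \<open>S\<close> step by step by \<open>bwd\<close>; where
  consecutive lifts end and start at different preimages of one element, \<open>fib\<close> connects
  them.\<close>

lemma card_conn_classes_quotient:
  assumes T: "f ` S = T"
    and fib: "\<And>x y. x \<in> S \<Longrightarrow> y \<in> S \<Longrightarrow> f x = f y \<Longrightarrow> (x, y) \<in> conn S R"
    and fwd: "\<And>x y. x \<in> S \<Longrightarrow> y \<in> S \<Longrightarrow> (x, y) \<in> R \<Longrightarrow> (f x, f y) \<in> conn T Q"
    and bwd: "\<And>x y. x \<in> S \<Longrightarrow> y \<in> S \<Longrightarrow> (f x, f y) \<in> Q \<Longrightarrow> (x, y) \<in> conn S R"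
  shows "card (conn_classes S R) = card (conn_classes T Q)"
proof (rule card_conn_classes_eq[OF T])
  fix x y assume x: "x \<in> S" and y: "y \<in> S"
  show "(x, y) \<in> conn S R \<longleftrightarrow> (f x, f y) \<in> conn T Q"
  proof
    assume "(x, y) \<in> conn S R"
    then show "(f x, f y) \<in> conn T Q" using x
    proof (induction rule: conn_induct)
      case (step y z)
      then show ?case
        using conn_trans[OF step.IH] fwd[of y z] conn_sym[OF fwd[of z y]] by blast
    qed simp
  next
    assume c: "(f x, f y) \<in> conn T Q"
    \<comment> \<open>The claim covers all preimages of the end point, so that the path can be
      continued from whichever preimage is chosen.\<close>
    have "\<forall>y\<in>S. f y = t \<longrightarrow> (x, y) \<in> conn S R" if "(f x, t) \<in> conn T Q" for t
    proof -
      have "f x \<in> T" using x T by auto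
      with that show ?thesis
      proof (induction rule: conn_induct)
        case refl
        then show ?case using x fib by metis
      next
        case (step s t)
        obtain z where z: "z \<in> S" "s = f z" using step.hyps(2) T by auto
        have xz: "(x, z) \<in> conn S R" using step z by auto
        show ?case
        proof (intro ballI impI)
          fix y assume y: "y \<in> S" "f y = t"
          have "(z, y) \<in> conn S R" using step.hyps(4) z(2) y(2) bwd[OF z(1) y(1)] conn_sym[OF bwd[OF y(1) z(1)]] by blast
          then show "(x, y) \<in> conn S R" using conn_trans[OF xz] by blast
        qed
      qed
    qed
    with c y show "(x, y) \<in> conn S R" by blast
  qed
qed

section \<open>Classes that meet or avoid a given set\<close>

text \<open>Every step of a path inside a class that avoids \<open>e\<close> starts outside
  \<open>e\<close>, where the two relations agree; so the class is the same for both.\<close>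

lemma conn_classes_off_subset:
  assumes agree: "\<And>a b. a \<notin> e \<or> b \<notin> e \<Longrightarrow> (a, b) \<in> R \<longleftrightarrow> (a, b) \<in> Q"
    and C: "C \<in> conn_classes S R" "C \<inter> e = {}"
  shows "C \<in> conn_classes S Q"
proof -
  obtain x where x: "x \<in> S" "C = conn S R `` {x}" using C(1) by (elim conn_classes_E)
  have "(x, y) \<in> conn S Q" if "(x, y) \<in> conn S R" for y
    using that x(1)
  proof (induction rule: conn_induct)
    case (step y z)
    have "y \<notin> e" using step.hyps(1) x C(2) by auto
    then have "(y, z) \<in> Q \<or> (z, y) \<in> Q" using step.hyps(4) agree[of y z] agree[of z y] by blast
    then show ?case using conn_extend[OF step.IH step.hyps(2,3)] by blast
  qed simp
  moreover have "(x, y) \<in> conn S R" if "(x, y) \<in> conn S Q" for y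
    using that x(1)
  proof (induction rule: conn_induct)
    case (step y z)
    have "y \<notin> e" using step.IH x C(2) by auto
    then have "(y, z) \<in> R \<or> (z, y) \<in> R" using step.hyps(4) agree[of y z] agree[of z y] by blast
    then show ?case using conn_extend[OF step.IH step.hyps(2,3)] by blast
  qed simp
  ultimately have "C = conn S Q `` {x}" using x(2) by blast
  then show ?thesis using x(1) by (simp add: conn_classes_I)
qed

lemma conn_classes_off:
  assumes "\<And>a b. a \<notin> e \<or> b \<notin> e \<Longrightarrow> (a, b) \<in> R \<longleftrightarrow> (a, b) \<in> Q"
  shows "{C \<in> conn_classes S R. C \<inter> e = {}} = {C \<in> conn_classes S Q. C \<inter> e = {}}"
  using conn_classes_off_subset[of e R Q _ S] conn_classes_off_subset[of e Q R _ S] assms by auto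

lemma conn_classes_disjoint:
  assumes "C \<in> conn_classes S R" "D \<in> conn_classes S R" "x \<in> C" "x \<in> D"
  shows "C = D"
  using conn_classes_mem(1)[OF assms(1,3)] conn_classes_mem(1)[OF assms(2,4)] by simp

text \<open>Both unions are the complement in \<open>S\<close> of the classes avoiding
  \<open>e\<close>, and those classes are common to \<open>R\<close> and \<open>Q\<close>.\<close>

lemma Union_conn_classes_meeting:
  assumes "\<And>a b. a \<notin> e \<or> b \<notin> e \<Longrightarrow> (a, b) \<in> R \<longleftrightarrow> (a, b) \<in> Q"
  shows "\<Union>{C \<in> conn_classes S R. C \<inter> e \<noteq> {}} = \<Union>{C \<in> conn_classes S Q. C \<inter> e \<noteq> {}}"
proof -
  have *: "\<Union>{C \<in> conn_classes S R. C \<inter> e \<noteq> {}} = S - \<Union>{C \<in> conn_classes S R. C \<inter> e = {}}" for R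
  proof (intro equalityI subsetI)
    fix x assume "x \<in> \<Union>{C \<in> conn_classes S R. C \<inter> e \<noteq> {}}"
    then obtain C where C: "C \<in> conn_classes S R" "C \<inter> e \<noteq> {}" "x \<in> C" by blast
    have "D \<inter> e \<noteq> {}" if "D \<in> conn_classes S R" "x \<in> D" for D
      using conn_classes_disjoint[OF C(1) that(1) C(3) that(2)] C(2) by simp
    then show "x \<in> S - \<Union>{C \<in> conn_classes S R. C \<inter> e = {}}"
      using conn_classes_mem(2)[OF C(1,3)] by auto
  next
    fix x assume x: "x \<in> S - \<Union>{C \<in> conn_classes S R. C \<inter> e = {}}"
    then have "x \<in> \<Union>(conn_classes S R)" by simp
    then obtain C where "C \<in> conn_classes S R" "x \<in> C" by (elim UnionE)
    with x show "x \<in> \<Union>{C \<in> conn_classes S R. C \<inter> e \<noteq> {}}" by blast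
  qed
  show ?thesis unfolding *[of R] *[of Q] using conn_classes_off[of e R Q S] assms by simp
qed

lemma card_conn_classes_split:
  assumes "finite S"
  shows "card (conn_classes S R)
    = card {C \<in> conn_classes S R. C \<inter> e = {}} + card {C \<in> conn_classes S R. C \<inter> e \<noteq> {}}"
proof -
  have "conn_classes S R
    = {C \<in> conn_classes S R. C \<inter> e = {}} \<union> {C \<in> conn_classes S R. C \<inter> e \<noteq> {}}" by auto
  then show ?thesis
    using card_Un_disjoint[of "{C \<in> conn_classes S R. C \<inter> e = {}}" "{C \<in> conn_classes S R. C \<inter> e \<noteq> {}}"]
      finite_conn_classes[OF assms, of R] by fastforce
qed

lemma conn_classes_meeting:
  assumes "e \<subseteq> S"
  shows "{C \<in> conn_classes S R. C \<inter> e \<noteq> {}} = (\<lambda>x. conn S R `` {x}) ` e"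
proof (intro equalityI subsetI)
  fix C assume "C \<in> {C \<in> conn_classes S R. C \<inter> e \<noteq> {}}"
  then obtain x where "C \<in> conn_classes S R" "x \<in> C" "x \<in> e" by blast
  then show "C \<in> (\<lambda>x. conn S R `` {x}) ` e" using conn_classes_mem(1)[of C S R x] by simp
next
  fix C assume "C \<in> (\<lambda>x. conn S R `` {x}) ` e"
  then obtain x where x: "x \<in> e" "C = conn S R `` {x}" by (elim imageE)
  then have "x \<in> C" "C \<in> conn_classes S R" using assms conn_classes_I[of x S R] by auto
  then show "C \<in> {C \<in> conn_classes S R. C \<inter> e \<noteq> {}}" using x(1) by blast
qed

text \<open>A path that starts in the closed set \<open>P\<close> never leaves it, so restricting
  the ground set to \<open>P\<close> does not change the classes of its elements.\<close>

lemma conn_classes_restrict: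
  assumes "P \<subseteq> S" and closed: "\<And>x y. x \<in> P \<Longrightarrow> (x, y) \<in> conn S R \<Longrightarrow> y \<in> P"
  shows "conn_classes P R = {C \<in> conn_classes S R. C \<subseteq> P}"
proof -
  have eq: "conn P R `` {x} = conn S R `` {x}" if "x \<in> P" for x
  proof (intro equalityI subsetI)
    fix y assume "y \<in> conn P R `` {x}"
    then have "(x, y) \<in> conn P R" by simp
    then have "(x, y) \<in> conn S R" using that
    proof (induction rule: conn_induct)
      case (step y z)
      then show ?case using conn_extend[OF step.IH] assms(1) by blast
    qed simp
    then show "y \<in> conn S R `` {x}" by simp
  next
    fix y assume "y \<in> conn S R `` {x}"
    then have "(x, y) \<in> conn S R" by simp
    have "x \<in> S" using that assms(1) by blast
    with \<open>(x, y) \<in> conn S R\<close> have "(x, y) \<in> conn P R"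
    proof (induction rule: conn_induct)
      case (step y z)
      have y: "y \<in> P" using closed[OF that step.hyps(1)] .
      have "(y, z) \<in> conn S R" using conn_extend[OF conn_refl step.hyps(2) step.hyps(3) step.hyps(4)] .
      then have "z \<in> P" using closed[OF y] by blast
      then show ?case using conn_extend[OF step.IH y] step.hyps(4) by blast
    qed simp
    then show "y \<in> conn P R `` {x}" by simp
  qed
  show ?thesis
  proof (intro equalityI subsetI)
    fix C assume "C \<in> conn_classes P R"
    then obtain x where x: "x \<in> P" "C = conn P R `` {x}" by (elim conn_classes_E)
    then have "C = conn S R `` {x}" using eq by simp
    moreover have "x \<in> S" using x(1) assms(1) by blast
    moreover have "conn S R `` {x} \<subseteq> P" using closed[OF x(1)] by blast
    ultimately show "C \<in> {C \<in> conn_classes S R. C \<subseteq> P}" using conn_classes_I[of x S R] by simp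
  next
    fix C assume C: "C \<in> {C \<in> conn_classes S R. C \<subseteq> P}"
    then obtain x where x: "x \<in> S" "C = conn S R `` {x}" by (auto elim!: conn_classes_E)
    then have "x \<in> P" using C conn_refl[of x S R] by blast
    then show "C \<in> conn_classes P R" using conn_classes_I[of x P R] eq[of x] x by simp
  qed
qed

section \<open>A single ribbon edge\<close>

lemma fpf_involution_onD:
  assumes "fpf_involution_on S f" "p \<in> S"
  shows "f p \<in> S" "f p \<noteq> p" "f (f p) = p"
  using assms by (simp_all add: fpf_involution_on_def)

text \<open>For arcs \<alpha> and segments \<sigma>, \<open>D = UNIV\<close> gives the vertex
  boundaries, and \<open>D = - e\<close> gives the vertex boundaries with the segments of the edge
  \<open>e\<close> cut out.\<close>

definition step_rel :: "('a \<Rightarrow> 'a) \<Rightarrow> ('a \<Rightarrow> 'a) \<Rightarrow> 'a set \<Rightarrow> 'a rel" where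
  "step_rel \<alpha> \<sigma> D = {(x, \<alpha> x) |x. True} \<union> {(x, \<sigma> x) |x. x \<in> D}"

lemma step_rel_UNIV: "step_rel \<alpha> \<sigma> UNIV = step_rel \<alpha> \<sigma> (- e) \<union> {(x, \<sigma> x) |x. x \<in> e}"
  by (auto simp: step_rel_def)

lemma conn_closed:
  assumes "(x, y) \<in> conn P R" "x \<in> P" "x \<in> X"
    and "\<And>a b. a \<in> X \<Longrightarrow> a \<in> P \<Longrightarrow> b \<in> P \<Longrightarrow> (a, b) \<in> R \<or> (b, a) \<in> R \<Longrightarrow> b \<in> X"
  shows "y \<in> X"
  using assms(1,2,3)
proof (induction rule: conn_induct)
  case (step y z)
  then show ?case using assms(4)[of y z] by blast
qed

text \<open>The four listed corners are distinct: \<sigma> (\<tau> p) = p would make \<sigma> and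
  \<tau> agree at p, against \<open>st\<close>, and the other coincidences would give a fixed point
  or such an agreement. Since \<open>e\<close> has four elements, they are all of it.\<close>

lemma four_cycle:
  assumes s: "fpf_involution_on e \<sigma>" and t: "fpf_involution_on e \<tau>"
    and st: "\<And>x. x \<in> e \<Longrightarrow> \<tau> x \<noteq> \<sigma> x" and e4: "card e = 4" and p: "p \<in> e"
  shows "e = {p, \<sigma> p, \<tau> p, \<sigma> (\<tau> p)}"
proof -
  note sD = fpf_involution_onD[OF s] and tD = fpf_involution_onD[OF t]
  have s': "\<sigma> (\<tau> x) \<noteq> x" "\<sigma> x \<noteq> x" "\<sigma> (\<sigma> x) = x" if "x \<in> e" for x
    using st[OF tD(1)[OF that]] tD(3)[OF that] sD(2,3)[OF that] by metis+
  have "card {p, \<sigma> p, \<tau> p, \<sigma> (\<tau> p)} = 4"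
    using s'[OF p] s'[OF tD(1)[OF p]] st[OF p] tD(2)[OF p] by (auto simp: card_insert_if)
  moreover have "finite e" using e4 card.infinite by fastforce
  ultimately show ?thesis
    using card_subset_eq[of e "{p, \<sigma> p, \<tau> p, \<sigma> (\<tau> p)}"] e4 p sD(1) tD(1) by auto
qed

section \<open>Two matchings and the walk that alternates between them\<close>

text \<open>Models the vertex boundaries of a ribbon graph: \<alpha> stands for the arcs, \<sigma>
  for the segments and \<open>e\<close> for the corners of one edge, a union of segments.\<close>

locale two_matchings =
  fixes P :: "'a set" and \<alpha> \<sigma> :: "'a \<Rightarrow> 'a" and e :: "'a set"
  assumes fin: "finite P"
    and a: "fpf_involution_on P \<alpha>" and s: "fpf_involution_on P \<sigma>"
    and eP: "e \<subseteq> P" and se: "\<And>x. x \<in> e \<Longrightarrow> \<sigma> x \<in> e"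
begin

lemmas aD = fpf_involution_onD[OF a]
lemmas sD = fpf_involution_onD[OF s]

text \<open>Runs around a vertex circle in a fixed direction, each unit of time crossing one arc and
  then one segment.\<close>

definition walk :: "nat \<Rightarrow> 'a \<Rightarrow> 'a" where
  "walk i = (\<sigma> \<circ> \<alpha>) ^^ i"

lemma walk_0 [simp]: "walk 0 x = x"
  by (simp add: walk_def)

lemma walk_Suc: "walk (Suc i) x = \<sigma> (\<alpha> (walk i x))"
  by (simp add: walk_def)

lemma walk_Suc2: "walk (Suc i) x = walk i (\<sigma> (\<alpha> x))"
  using funpow_swap1[of "\<sigma> \<circ> \<alpha>" i x] by (simp add: walk_def)

lemma walk_add: "walk (i + j) x = walk i (walk j x)"
  by (simp add: walk_def funpow_add)

lemma walk_in: "x \<in> P \<Longrightarrow> walk i x \<in> P"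
  by (induction i) (auto simp: walk_Suc aD(1) sD(1))

text \<open>A coincidence can be conjugated by the walk into a fixed point of \<open>\<alpha>\<close> or \<open>\<sigma>\<close>.\<close>

lemma walk_neq: "x \<in> P \<Longrightarrow> walk k x \<noteq> \<alpha> x"
proof (induction k arbitrary: x rule: less_induct)
  case (less k)
  consider "k = 0" | "k = 1" | j where "k = Suc (Suc j)"
    by (metis One_nat_def not0_implies_Suc)
  then show ?case
  proof cases
    case 1
    then show ?thesis using aD(2)[OF less.prems] by simp
  next
    case 2
    then show ?thesis using sD(2)[OF aD(1)[OF less.prems]] by (simp add: walk_Suc)
  next
    case 3
    let ?z = "\<sigma> (\<alpha> x)"
    have z: "?z \<in> P" "\<alpha> ?z \<in> P" "\<alpha> x \<in> P" by (simp_all add: less.prems aD(1) sD(1))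
    show ?thesis
    proof
      assume "walk k x = \<alpha> x"
      then have "\<sigma> (\<alpha> (walk j ?z)) = \<alpha> x" by (simp only: 3 walk_Suc2[of "Suc j"] walk_Suc[of j])
      moreover have "walk j ?z \<in> P" using walk_in z(1) .
      ultimately have "walk j ?z = \<alpha> ?z" using aD sD z by metis
      then show False using less.IH[of j ?z] 3 z(1) by simp
    qed
  qed
qed

text \<open>The vertex circle is bipartite: the positions of the walk after a segment never coincide
  with those after an arc. The case distinction starts the walk at the earlier of the two positions,
  which reduces the claim to \<open>walk_neq\<close>.\<close>

lemma walk_neq2:
  assumes "p \<in> P"
  shows "walk i p \<noteq> \<alpha> (walk j p)"
proof (cases "j \<le> i")
  case True
  then show ?thesis using walk_neq[of "walk j p" "i - j"] walk_in[OF assms] walk_add[of "i - j" j p] by simp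
next
  case False
  then have "walk j p \<noteq> \<alpha> (walk i p)"
    using walk_neq[of "walk i p" "j - i"] walk_in[OF assms] walk_add[of "j - i" i p] by simp
  then show ?thesis using aD(3)[OF walk_in[OF assms]] by metis
qed

lemma walk_periodic:
  assumes "p \<in> P"
  obtains m where "walk (Suc m) p = p"
proof -
  \<comment> \<open>Both involutions can be undone, so a repetition at times \<open>i\<close> and
    \<open>i + d\<close> moves back to time 0; finiteness of \<open>P\<close> provides a
    repetition.\<close>
  have cancel: "walk i p = walk (i + d) p \<Longrightarrow> walk d p = p" for i d
  proof (induction i)
    case (Suc i)
    have "\<alpha> (walk i p) = \<alpha> (walk (i + d) p)"
      using Suc.prems sD(3)[OF aD(1)[OF walk_in[OF assms]]] by (metis walk_Suc add_Suc)
    then have "walk i p = walk (i + d) p" using aD(3)[OF walk_in[OF assms]] by metis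
    then show ?case by (rule Suc.IH)
  qed simp
  have "\<not> inj (\<lambda>i. walk i p)"
  proof
    assume "inj (\<lambda>i. walk i p)"
    moreover have "range (\<lambda>i. walk i p) \<subseteq> P" using walk_in[OF assms] by blast
    ultimately show False using fin finite_imageD finite_subset infinite_UNIV_nat by blast
  qed
  then obtain i j where ij: "walk i p = walk j p" "i \<noteq> j" by (auto simp: inj_def)
  obtain k d where "walk k p = walk (k + Suc d) p"
  proof (cases "i < j")
    case True
    then show ?thesis using that[of i "j - i - 1"] ij by simp
  next
    case False
    then show ?thesis using that[of j "i - j - 1"] ij by simp
  qed
  then show ?thesis using cancel that by blast
qed

text \<open>What remains of the vertex boundaries when the segments of \<open>e\<close> are cut out:
  paths joining the corners of \<open>e\<close> in pairs, and possibly circles that miss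
  \<open>e\<close>.\<close>

abbreviation off :: "'a rel" where
  "off \<equiv> step_rel \<alpha> \<sigma> (- e)"

text \<open>The mate of \<open>p\<close> is where the walk from \<open>p\<close> first returns to \<open>e\<close>.\<close>

lemma mate_exists:
  assumes p: "p \<in> e"
  obtains q where "q \<in> e" "q \<noteq> p" "conn P off `` {p} \<inter> e = {p, q}"
    "\<And>S. (\<And>x. (p, x) \<in> conn P off \<Longrightarrow> (\<alpha> x \<in> S \<longleftrightarrow> x \<notin> S) \<and> (x \<notin> e \<longrightarrow> (\<sigma> x \<in> S \<longleftrightarrow> x \<notin> S)))
      \<Longrightarrow> q \<in> S \<longleftrightarrow> p \<notin> S"
proof -
  have pP: "p \<in> P" using p eP by blast
  note wP = walk_in[OF pP]
  obtain m where m: "walk (Suc m) p = p" using walk_periodic[OF pP] .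
  \<comment> \<open>Just before the walk closes up at p it crosses the segment of p, so its last arc
    ends at \<sigma> p, a corner of \<open>e\<close>. Hence the minimum below exists.\<close>
  have "\<alpha> (walk m p) = \<sigma> p"
    using m sD(3)[OF aD(1)[OF wP]] by (metis walk_Suc)
  then have ex: "\<alpha> (walk m p) \<in> e" using se[OF p] by simp
  define n where "n = (LEAST n. \<alpha> (walk n p) \<in> e)"
  define q where "q = \<alpha> (walk n p)"
  have qe: "q \<in> e" unfolding q_def n_def using ex by (rule LeastI)
  have before: "\<alpha> (walk i p) \<notin> e" if "i < n" for i
    using not_less_Least[of i "\<lambda>n. \<alpha> (walk n p) \<in> e"] that by (simp add: n_def)
  have walk_off: "walk (Suc i) p \<notin> e" if "i < n" for i
  proof
    assume "walk (Suc i) p \<in> e"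
    then have "\<sigma> (walk (Suc i) p) \<in> e" by (rule se)
    then have "\<alpha> (walk i p) \<in> e" using sD(3)[OF aD(1)[OF wP]] by (simp add: walk_Suc)
    with before[OF that] show False ..
  qed
  have conn_a: "(p, \<alpha> x) \<in> conn P off" if "(p, x) \<in> conn P off" for x
  proof (rule conn_extend[OF that])
    show "x \<in> P" using conn_in[OF that pP] .
    then show "\<alpha> x \<in> P" by (rule aD(1))
  qed (auto simp: step_rel_def)
  have conn_walk: "(p, walk i p) \<in> conn P off" if "i \<le> n" for i
    using that
  proof (induction i)
    case (Suc i)
    have "(p, \<alpha> (walk i p)) \<in> conn P off" using Suc conn_a by simp
    then show ?case
    proof (rule conn_extend)
      show "\<alpha> (walk i p) \<in> P" using aD(1)[OF wP] .
      show "walk (Suc i) p \<in> P" using wP .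
      show "(\<alpha> (walk i p), walk (Suc i) p) \<in> off \<or> (walk (Suc i) p, \<alpha> (walk i p)) \<in> off"
        using before[of i] Suc.prems by (auto simp: step_rel_def walk_Suc)
    qed
  qed simp
  \<comment> \<open>The path from p to q written out. It is closed under \<alpha>, and under
    \<sigma> away from \<open>e\<close>, so it contains the whole \<open>off\<close>-class of
    p.\<close>
  define X where "X = {walk i p |i. i \<le> n} \<union> {\<alpha> (walk i p) |i. i \<le> n}"
  have Xa: "\<alpha> x \<in> X" if "x \<in> X" for x
    using that aD(3)[OF wP] unfolding X_def by auto
  have Xs: "\<sigma> x \<in> X" if x: "x \<in> X" "x \<notin> e" for x
  proof -
    from x(1) consider i where "x = walk i p" "i \<le> n" | i where "x = \<alpha> (walk i p)" "i \<le> n"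
      unfolding X_def by blast
    then show ?thesis
    proof cases
      case 1
      then obtain j where j: "i = Suc j" using x(2) p by (cases i) auto
      then have "\<sigma> x = \<alpha> (walk j p)" using 1 sD(3)[OF aD(1)[OF wP]] by (simp add: walk_Suc)
      then show ?thesis using 1 j unfolding X_def by auto
    next
      case 2
      then have "i < n" using x(2) qe unfolding q_def by (cases "i = n") auto
      then show ?thesis using 2 unfolding X_def by (auto simp: walk_Suc[symmetric] intro: Suc_leI)
    qed
  qed
  have sub: "y \<in> X" if "(p, y) \<in> conn P off" for y
    using that pP
  proof (rule conn_closed)
    show "p \<in> X" unfolding X_def using walk_0[of p] by force
    fix x y assume x: "x \<in> X" "x \<in> P" "y \<in> P" "(x, y) \<in> off \<or> (y, x) \<in> off"
    then consider "y = \<alpha> x" | "y = \<sigma> x" "x \<notin> e" | "x = \<alpha> y" | "x = \<sigma> y" "y \<notin> e"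
      by (auto simp: step_rel_def)
    then show "y \<in> X"
    proof cases
      case 3
      then have "y = \<alpha> x" using aD(3)[OF x(3)] by simp
      then show ?thesis using Xa x by simp
    next
      case 4
      then have "y = \<sigma> x" using sD(3)[OF x(3)] by simp
      moreover from this have "x \<notin> e" using 4 se by blast
      ultimately show ?thesis using Xs x by simp
    qed (use x Xa Xs in auto)
  qed
  have Xe: "X \<inter> e \<subseteq> {p, q}"
  proof
    fix x assume x: "x \<in> X \<inter> e"
    then consider i where "x = walk i p" "i \<le> n" | i where "x = \<alpha> (walk i p)" "i \<le> n"
      unfolding X_def by blast
    then show "x \<in> {p, q}"
    proof cases
      case 1
      then show ?thesis using x walk_off by (cases i) auto
    next
      case 2
      then show ?thesis using x before[of i] by (cases "i = n") (auto simp: q_def)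
    qed
  qed
  show ?thesis
  proof (rule that[OF qe])
    show "q \<noteq> p" using walk_neq2[OF pP, of 0 n] by (simp add: q_def)
    have "(p, q) \<in> conn P off" unfolding q_def using conn_a conn_walk by blast
    then show "conn P off `` {p} \<inter> e = {p, q}" using sub Xe p qe conn_refl[of p P off] by blast
  next
    fix S assume S: "\<And>x. (p, x) \<in> conn P off \<Longrightarrow>
      (\<alpha> x \<in> S \<longleftrightarrow> x \<notin> S) \<and> (x \<notin> e \<longrightarrow> (\<sigma> x \<in> S \<longleftrightarrow> x \<notin> S))"
    \<comment> \<open>The path from p to q has n + 1 arcs and n segments. Each step changes sides,
      and the number of steps is odd.\<close>
    have "walk i p \<in> S \<longleftrightarrow> p \<in> S" if "i \<le> n" for i
      using that
    proof (induction i)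
      case (Suc i)
      have "(\<alpha> (walk i p) \<in> S) = (walk i p \<notin> S)"
        using S[OF conn_walk[of i]] Suc.prems by simp
      moreover have "(\<sigma> (\<alpha> (walk i p)) \<in> S) = (\<alpha> (walk i p) \<notin> S)"
        using S[OF conn_a[OF conn_walk[of i]]] before[of i] Suc.prems by simp
      ultimately show ?case using Suc by (simp add: walk_Suc)
    qed simp
    then show "q \<in> S \<longleftrightarrow> p \<notin> S" using S[OF conn_walk[of n]] by (simp add: q_def)
  qed
qed

section \<open>Vertices, boundary components and orientability at one edge\<close>

text \<open>Applied with \<kappa> = \<sigma> to count vertices and with \<kappa> = \<tau> to count
  boundary components. Under \<kappa> the corners form two pairs; these lie in different classes
  exactly if the path from p returns to the pair of p.\<close>

lemma card_classes_meeting: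
  assumes k: "fpf_involution_on e \<kappa>" and e4: "card e = 4" and p: "p \<in> e"
    and q: "q \<in> e" "q \<noteq> p" "conn P off `` {p} \<inter> e = {p, q}"
  shows "card {C \<in> conn_classes P (off \<union> {(x, \<kappa> x) |x. x \<in> e}). C \<inter> e \<noteq> {}}
    = (if q = \<kappa> p then 2 else 1)"
proof -
  define R where "R = off \<union> {(x, \<kappa> x) |x. x \<in> e}"
  note kD = fpf_involution_onD[OF k]
  have pP: "p \<in> P" using p eP by blast
  have fe: "finite e" using fin eP finite_subset by blast
  have "\<not> e \<subseteq> {p, \<kappa> p}"
  proof
    assume "e \<subseteq> {p, \<kappa> p}"
    then have "card e \<le> card {p, \<kappa> p}" by (simp add: card_mono)
    also have "\<dots> \<le> 2" by (simp add: card_insert_if)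
    finally show False using e4 by simp
  qed
  \<comment> \<open>A representative of the pair that does not contain p.\<close>
  then obtain r where r: "r \<in> e" "r \<noteq> p" "r \<noteq> \<kappa> p" by blast
  have d: "\<kappa> r \<noteq> p" "\<kappa> r \<noteq> \<kappa> p" "\<kappa> r \<noteq> r" "\<kappa> p \<noteq> p"
    using r kD p by metis+
  have "card {p, \<kappa> p, r, \<kappa> r} = 4" using r d by auto
  then have e: "e = {p, \<kappa> p, r, \<kappa> r}"
    using card_subset_eq[OF fe, of "{p, \<kappa> p, r, \<kappa> r}"] e4 p r(1) kD(1) by auto
  have k_conn: "(x, \<kappa> x) \<in> conn P R" if "x \<in> e" for x
    by (rule conn_step) (use that kD(1)[OF that] eP in \<open>auto simp: R_def\<close>)
  let ?c = "\<lambda>x. conn P R `` {x}"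
  have c: "?c (\<kappa> p) = ?c p" "?c (\<kappa> r) = ?c r"
    using k_conn[OF p] k_conn[OF r(1)] conn_class_eq by metis+
  have im: "{C \<in> conn_classes P R. C \<inter> e \<noteq> {}} = {?c p, ?c r}"
    unfolding conn_classes_meeting[OF eP] using c by (subst e) simp
  show ?thesis
  proof (cases "q = \<kappa> p")
    case True
    have "(p, r) \<notin> conn P R"
    proof
      assume "(p, r) \<in> conn P R"
      \<comment> \<open>If q = \<kappa> p, the \<open>off\<close>-class of p meets \<open>e\<close>
        only in the pair of p, so \<kappa> does not lead out of it.\<close>
      then have "r \<in> conn P off `` {p}"
      proof (rule conn_closed[OF _ pP])
        show "p \<in> conn P off `` {p}" by simp
        fix x y assume x: "x \<in> conn P off `` {p}" "x \<in> P" "y \<in> P" "(x, y) \<in> R \<or> (y, x) \<in> R"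
        show "y \<in> conn P off `` {p}"
        proof (cases "(x, y) \<in> off \<or> (y, x) \<in> off")
          case True
          then show ?thesis using x conn_extend[of p x P off y] by blast
        next
          case False
          then have "x \<in> e" "y \<in> e" "y = \<kappa> x" using x(4) kD by (auto simp: R_def)
          moreover from this have "x \<in> {p, \<kappa> p}" using x(1) q(3) True by blast
          ultimately have "y \<in> {p, q}" using True kD(3)[OF p] by auto
          then show ?thesis using q(3) by blast
        qed
      qed
      then have "r \<in> {p, q}" using r(1) q(3) by blast
      then show False using r True by simp
    qed
    then have "?c p \<noteq> ?c r" unfolding conn_class_eq_iff .
    then show ?thesis using True im by (simp add: R_def)
  next
    case False
    have "(p, q) \<in> conn P off" using q(3) by blast
    then have "(p, q) \<in> conn P R" by (rule conn_mono) (simp add: R_def)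
    then have "?c q = ?c p" using conn_class_eq by metis
    moreover have "q = r \<or> q = \<kappa> r" using False q e by blast
    ultimately have "?c r = ?c p" using c by auto
    then show ?thesis using False im by (simp add: R_def)
  qed
qed

text \<open>As q is neither p nor \<sigma> p, it is \<tau> p or the diagonal corner \<sigma> (\<tau>
  p). An orientation puts q on the side opposite to p by \<open>flip\<close> but the diagonal corner
  on the side of p, which excludes the diagonal. Conversely, the bipartition of the vertex circle
  orients the loop if q = \<tau> p.\<close>

lemma orientable_one_vertex:
  assumes t: "fpf_involution_on e \<tau>" and st: "\<And>x. x \<in> e \<Longrightarrow> \<tau> x \<noteq> \<sigma> x"
    and e4: "card e = 4" and p: "p \<in> e"
    and q: "q \<in> e" "q \<noteq> p" "q \<noteq> \<sigma> p" "conn P off `` {p} \<inter> e = {p, q}"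
    and flip: "\<And>S. (\<And>x. (p, x) \<in> conn P off \<Longrightarrow> (\<alpha> x \<in> S \<longleftrightarrow> x \<notin> S) \<and> (x \<notin> e \<longrightarrow> (\<sigma> x \<in> S \<longleftrightarrow> x \<notin> S)))
      \<Longrightarrow> q \<in> S \<longleftrightarrow> p \<notin> S"
    and C: "C = conn P (step_rel \<alpha> \<sigma> UNIV) `` {p}" "e \<subseteq> C"
  shows "(\<exists>S. \<forall>x\<in>C. (\<alpha> x \<in> S \<longleftrightarrow> x \<notin> S) \<and> (\<sigma> x \<in> S \<longleftrightarrow> x \<notin> S) \<and> (x \<in> e \<longrightarrow> (\<tau> x \<in> S \<longleftrightarrow> x \<notin> S)))
    \<longleftrightarrow> q = \<tau> p"
proof
  note tD = fpf_involution_onD[OF t]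
  have pP: "p \<in> P" using p eP by blast
  have sub: "x \<in> C" if "(p, x) \<in> conn P off" for x
    using conn_mono[OF that, of "step_rel \<alpha> \<sigma> UNIV"] by (auto simp: C(1) step_rel_def)
  have s': "fpf_involution_on e \<sigma>"
    using se sD eP by (auto simp: fpf_involution_on_def)
  have se': "\<sigma> (\<tau> x) \<noteq> x" "\<sigma> x \<noteq> x" "\<sigma> (\<sigma> x) = x" if "x \<in> e" for x
    using st[OF tD(1)[OF that]] tD(3)[OF that] fpf_involution_onD[OF s' that] by metis+
  have e: "e = {p, \<sigma> p, \<tau> p, \<sigma> (\<tau> p)}" by (rule four_cycle[OF s' t st e4 p])
  have "\<tau> (\<sigma> p) \<noteq> p" "\<tau> (\<sigma> p) \<noteq> \<sigma> p" "\<tau> (\<sigma> p) \<noteq> \<tau> p"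
    using tD[OF se[OF p]] tD[OF p] st[OF p] se'[OF p] by metis+
  then have tsp: "\<tau> (\<sigma> p) = \<sigma> (\<tau> p)" using tD(1)[OF se[OF p]] e by blast
  {
    assume "\<exists>S. \<forall>x\<in>C. (\<alpha> x \<in> S \<longleftrightarrow> x \<notin> S) \<and> (\<sigma> x \<in> S \<longleftrightarrow> x \<notin> S) \<and> (x \<in> e \<longrightarrow> (\<tau> x \<in> S \<longleftrightarrow> x \<notin> S))"
    then obtain S where S: "\<And>x. x \<in> C \<Longrightarrow> (\<alpha> x \<in> S \<longleftrightarrow> x \<notin> S) \<and> (\<sigma> x \<in> S \<longleftrightarrow> x \<notin> S) \<and> (x \<in> e \<longrightarrow> (\<tau> x \<in> S \<longleftrightarrow> x \<notin> S))"
      by blast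
    have "q \<in> S \<longleftrightarrow> p \<notin> S" by (rule flip) (use S sub in blast)
    moreover have "\<sigma> (\<tau> p) \<in> S \<longleftrightarrow> p \<in> S" using S[of p] S[of "\<tau> p"] p tD(1)[OF p] C(2) by blast
    ultimately have "q \<noteq> \<sigma> (\<tau> p)" by blast
    then show "q = \<tau> p" using q e by blast
  }
  assume qt: "q = \<tau> p"
  \<comment> \<open>One half of the bipartition of the vertex circle; the points after an arc form
    the other half.\<close>
  define S where "S = range (\<lambda>i. walk i p)"
  have wP: "walk i p \<in> P" for i using walk_in[OF pP] .
  obtain m where m: "walk (Suc m) p = p" using walk_periodic[OF pP] .
  have disj: "\<alpha> x \<notin> S" if "x \<in> S" for x
    using that walk_neq2[OF pP] unfolding S_def by (metis (no_types, lifting) imageE)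
  have ss: "\<sigma> x \<in> S" if xS: "\<alpha> x \<in> S" "x \<in> P" for x
  proof -
    obtain i where i: "\<alpha> x = walk i p" using xS unfolding S_def by blast
    have "\<sigma> x = walk (Suc i) p" using aD(3)[OF xS(2)] by (simp add: walk_Suc i[symmetric])
    then show ?thesis unfolding S_def by blast
  qed
  have sa: "\<alpha> (\<sigma> x) \<in> S" if xS: "x \<in> S" for x
  proof -
    obtain i where i: "x = walk i p" using xS unfolding S_def by blast
    \<comment> \<open>Time 0 has no predecessor, so it is replaced by the full period
      \<open>Suc m\<close>.\<close>
    obtain j where "x = walk (Suc j) p"
    proof (cases i)
      case 0
      then have "x = walk (Suc m) p" unfolding m using i by simp
      then show ?thesis by (rule that)
    qed (use i that in blast)
    then have "\<alpha> (\<sigma> x) = walk j p" using sD(3)[OF aD(1)[OF wP]] aD(3)[OF wP] by (simp add: walk_Suc)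
    then show ?thesis unfolding S_def by blast
  qed
  have split: "x \<in> S \<or> \<alpha> x \<in> S" if "x \<in> C" for x
  proof -
    have "(p, x) \<in> conn P (step_rel \<alpha> \<sigma> UNIV)" using that C(1) by simp
    then have "x \<in> {x. x \<in> S \<or> \<alpha> x \<in> S}"
    proof (rule conn_closed[OF _ pP])
      show "p \<in> {x. x \<in> S \<or> \<alpha> x \<in> S}" unfolding S_def using walk_0[of p] by (metis (mono_tags, lifting) mem_Collect_eq rangeI)
      fix x y assume x: "x \<in> {x. x \<in> S \<or> \<alpha> x \<in> S}" "x \<in> P" "y \<in> P"
        "(x, y) \<in> step_rel \<alpha> \<sigma> UNIV \<or> (y, x) \<in> step_rel \<alpha> \<sigma> UNIV"
      then have "y = \<alpha> x \<or> y = \<sigma> x" using aD(3)[OF x(3)] sD(3)[OF x(3)] by (auto simp: step_rel_def)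
      then show "y \<in> {x. x \<in> S \<or> \<alpha> x \<in> S}"
      proof
        assume "y = \<alpha> x"
        then show ?thesis using x(1) aD(3)[OF x(2)] by auto
      next
        assume "y = \<sigma> x"
        then show ?thesis using x(1) ss[OF _ x(2)] sa[of x] by auto
      qed
    qed
    then show ?thesis by simp
  qed
  have CP: "C \<subseteq> P" using conn_in[OF _ pP] C(1) by blast
  have Ca: "\<alpha> x \<in> C" "\<sigma> x \<in> C" if "x \<in> C" for x
  proof -
    have xP: "x \<in> P" and px: "(p, x) \<in> conn P (step_rel \<alpha> \<sigma> UNIV)" using that CP C(1) by auto
    show "\<alpha> x \<in> C" "\<sigma> x \<in> C" unfolding C(1)
      using conn_extend[OF px xP aD(1)[OF xP]] conn_extend[OF px xP sD(1)[OF xP]]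
      by (auto simp: step_rel_def)
  qed
  have fa: "\<alpha> x \<in> S \<longleftrightarrow> x \<notin> S" if "x \<in> C" for x
    using split[OF that] disj[of x] by blast
  have fs: "\<sigma> x \<in> S \<longleftrightarrow> x \<notin> S" if "x \<in> C" for x
    using fa[OF that] fa[OF Ca(2)[OF that]] ss[of x] sa[of x] that CP by blast
  \<comment> \<open>The side at p joins the two ends of the path from p to q, to which
    \<open>flip\<close> applies. The other side of the edge follows because \<sigma> changes sides
    and commutes with \<tau> at p.\<close>
  have fp: "\<tau> p \<in> S \<longleftrightarrow> p \<notin> S"
    unfolding qt[symmetric] by (rule flip) (use fa fs sub in blast)
  have ft: "\<tau> x \<in> S \<longleftrightarrow> x \<notin> S" if "x \<in> e" for x
  proof -
    have f1: "\<sigma> p \<in> S \<longleftrightarrow> p \<notin> S" "\<sigma> (\<tau> p) \<in> S \<longleftrightarrow> \<tau> p \<notin> S"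
      using fs C(2) p tD(1)[OF p] by blast+
    have t1: "\<tau> (\<tau> p) = p" "\<tau> (\<sigma> (\<tau> p)) = \<sigma> p"
      using tD(3)[OF p] tD(3)[OF se[OF p]] tsp by simp_all
    have "x = p \<or> x = \<sigma> p \<or> x = \<tau> p \<or> x = \<sigma> (\<tau> p)" using that e by blast
    then show ?thesis using f1 t1 fp tsp by auto
  qed
  show "\<exists>S. \<forall>x\<in>C. (\<alpha> x \<in> S \<longleftrightarrow> x \<notin> S) \<and> (\<sigma> x \<in> S \<longleftrightarrow> x \<notin> S) \<and> (x \<in> e \<longrightarrow> (\<tau> x \<in> S \<longleftrightarrow> x \<notin> S))"
    by (rule exI[of _ S]) (use fa fs ft in blast)
qed

text \<open>The mate q of one corner p decides everything: q = \<sigma> p gives two vertices, q =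
  \<tau> p an orientable loop with two boundary components, and the diagonal q a non-orientable
  loop. The first two cases exclude each other by \<open>st\<close>.\<close>

lemma single_edge_trichotomy:
  assumes t: "fpf_involution_on e \<tau>" and st: "\<And>x. x \<in> e \<Longrightarrow> \<tau> x \<noteq> \<sigma> x" and e4: "card e = 4"
  defines "V \<equiv> {C \<in> conn_classes P (step_rel \<alpha> \<sigma> UNIV). C \<inter> e \<noteq> {}}"
    and "F \<equiv> {C \<in> conn_classes P (off \<union> {(x, \<tau> x) |x. x \<in> e}). C \<inter> e \<noteq> {}}"
  defines "ori \<equiv> \<exists>S. \<forall>x\<in>\<Union>V. (\<alpha> x \<in> S \<longleftrightarrow> x \<notin> S) \<and> (\<sigma> x \<in> S \<longleftrightarrow> x \<notin> S) \<and> (x \<in> e \<longrightarrow> (\<tau> x \<in> S \<longleftrightarrow> x \<notin> S))"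
  shows "card V = 2 \<and> card F = 1 \<or> card V = 1 \<and> card F = 2 \<and> ori \<or> card V = 1 \<and> card F = 1 \<and> \<not> ori"
proof -
  obtain p where p: "p \<in> e" using e4 by fastforce
  obtain q where q: "q \<in> e" "q \<noteq> p" "conn P off `` {p} \<inter> e = {p, q}"
    and flip: "\<And>S. (\<And>x. (p, x) \<in> conn P off \<Longrightarrow> (\<alpha> x \<in> S \<longleftrightarrow> x \<notin> S) \<and> (x \<notin> e \<longrightarrow> (\<sigma> x \<in> S \<longleftrightarrow> x \<notin> S)))
      \<Longrightarrow> q \<in> S \<longleftrightarrow> p \<notin> S"
    using mate_exists[OF p] by blast
  have s': "fpf_involution_on e \<sigma>"
    using se sD eP by (auto simp: fpf_involution_on_def)
  have cV: "card V = (if q = \<sigma> p then 2 else 1)"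
    unfolding V_def step_rel_UNIV[of \<alpha> \<sigma> e] by (rule card_classes_meeting[OF s' e4 p q])
  have cF: "card F = (if q = \<tau> p then 2 else 1)"
    unfolding F_def by (rule card_classes_meeting[OF t e4 p q])
  show ?thesis
  proof (cases "q = \<sigma> p")
    case True
    then show ?thesis using cV cF st[OF p] by simp
  next
    case False
    let ?C = "conn P (step_rel \<alpha> \<sigma> UNIV) `` {p}"
    have "?C \<in> V" unfolding V_def conn_classes_meeting[OF eP] using p by blast
    moreover have "card V = 1" using cV False by simp
    ultimately have V: "V = {?C}" by (auto simp: card_1_singleton_iff)
    have "e \<subseteq> \<Union>V" unfolding V_def conn_classes_meeting[OF eP] by auto
    then have eC: "e \<subseteq> ?C" using V by simp
    have "ori \<longleftrightarrow> q = \<tau> p"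
      unfolding ori_def V using orientable_one_vertex[OF t st e4 p q(1,2) False q(3) flip refl eC] by simp
    then show ?thesis using cV cF False by simp
  qed
qed

end

section \<open>Counting boundary components and colour classes\<close>

text \<open>The generating relation of \<open>bdry\<close> with the edge set as a separate argument,
  so that all spanning subgraphs are compared inside one graph.\<close>

definition bdry_rel :: "('a, 'z) ribbon_graph_scheme \<Rightarrow> 'a set set \<Rightarrow> 'a rel" where
  "bdry_rel G A = {(p, arc G p) |p. True} \<union> {(p, side G p) |p. p \<in> \<Union>A} \<union> {(p, seg G p) |p. p \<notin> \<Union>A}"

text \<open>This is \<open>b(A)\<close>; in particular \<open>nbdry G {}\<close> counts the vertices.\<close>

definition nbdry :: "('a, 'z) ribbon_graph_scheme \<Rightarrow> 'a set set \<Rightarrow> nat" where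
  "nbdry G A = card (conn_classes (points G) (bdry_rel G A))"

lemma bdry_eq: "bdry G = conn_classes (points G) (bdry_rel G (edges G))"
  by (simp add: bdry_def bdry_rel_def)

lemma verts_eq: "verts G = conn_classes (points G) (bdry_rel G {})"
  by (simp add: verts_def bdry_rel_def)

lemma card_verts: "card (verts G) = nbdry G {}"
  by (simp add: verts_eq nbdry_def)

lemma card_bdry: "card (bdry G) = nbdry G (edges G)"
  by (simp add: bdry_eq nbdry_def)

lemma card_bdry_update: "card (bdry (G\<lparr>edges := A\<rparr>)) = nbdry G A"
  by (simp add: card_bdry) (simp add: nbdry_def bdry_rel_def)

section \<open>Colour classes as classes of points\<close>

text \<open>Colours are moved from boundary components to points, because deletion alters the
  components while all minors share their points.\<close>

definition colour_rel :: "'a bcrg \<Rightarrow> 'a rel" where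
  "colour_rel G = {(x, y). \<exists>C\<in>colours G. x \<in> \<Union>C \<and> y \<in> \<Union>C}"

text \<open>An edge of the colour graph joins the colours found at its corners; here this becomes an
  identification of the corners themselves.\<close>

definition merge_rel :: "'a set set \<Rightarrow> 'a rel" where
  "merge_rel B = (\<Union>e\<in>B. e \<times> e)"

text \<open>The number of components of the spanning subgraph of the colour graph with edge set \<open>B\<close>,
  expressed through points of the ribbon graph so that it behaves well under minors.\<close>

definition ncolour :: "'a bcrg \<Rightarrow> 'a set set \<Rightarrow> nat" where
  "ncolour G B = card (conn_classes (points G) (colour_rel G \<union> merge_rel B))"

lemma bcrgD:
  assumes "bcrg G"
  shows "ribbon_graph G" "finite (points G)" "fpf_involution_on (points G) (arc G)"
    "fpf_involution_on (points G) (seg G)" "disjoint (edges G)" "partition_on (bdry G) (colours G)"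
  using assms by (simp_all add: bcrg_def ribbon_graph_def)

lemma ribbon_graph_edgeD:
  assumes "ribbon_graph G" "e \<in> edges G"
  shows "e \<subseteq> points G" "card e = 4" "fpf_involution_on e (seg G)" "fpf_involution_on e (side G)"
    "\<And>p. p \<in> e \<Longrightarrow> side G p \<noteq> seg G p"
  using assms by (auto simp: ribbon_graph_def)

lemma ribbon_graph_edge_unique:
  assumes "ribbon_graph G" "e \<in> edges G" "f \<in> edges G" "p \<in> e" "p \<in> f"
  shows "e = f"
  using assms disjointD[of "edges G" e f] by (auto simp: ribbon_graph_def)

lemma finite_edges:
  assumes "ribbon_graph G"
  shows "finite (edges G)"
proof -
  have "edges G \<subseteq> Pow (points G)" using ribbon_graph_edgeD(1)[OF assms] by blast
  moreover have "finite (points G)" using assms by (simp add: ribbon_graph_def)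
  ultimately show ?thesis by (simp add: finite_subset)
qed

text \<open>Adding or removing \<open>e\<close> only exchanges segments of \<open>e\<close> for
  sides of \<open>e\<close>, and both kinds of step stay inside \<open>e\<close>.\<close>

lemma bdry_rel_agree:
  assumes G: "ribbon_graph G" and e: "e \<in> edges G" and AA: "A \<subseteq> edges G" "A' \<subseteq> edges G" "A - {e} = A' - {e}"
    and ab: "a \<notin> e \<or> b \<notin> e"
  shows "(a, b) \<in> bdry_rel G A \<longleftrightarrow> (a, b) \<in> bdry_rel G A'"
proof -
  note eD = fpf_involution_onD[OF ribbon_graph_edgeD(3)[OF G e]] fpf_involution_onD[OF ribbon_graph_edgeD(4)[OF G e]]
  have off: "p \<in> \<Union>A \<longleftrightarrow> p \<in> \<Union>A'" if "p \<notin> e" for p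
    using that AA(3) by blast
  show ?thesis
  proof (cases "a \<in> e")
    case True
    then have "b \<notin> e" using ab by blast
    then have "b \<noteq> seg G a" "b \<noteq> side G a" using eD(1,4) True by auto
    then show ?thesis by (auto simp: bdry_rel_def)
  next
    case False
    then show ?thesis using off[of a] by (auto simp: bdry_rel_def)
  qed
qed

lemma colours_Union_eq:
  assumes "bcrg G"
  shows "\<Union>(\<Union>(colours G)) = points G"
  using partition_onD1[OF bcrgD(6)[OF assms]] by (metis Union_conn_classes bdry_eq)

lemma colour_cases:
  assumes "bcrg G" "x \<in> points G"
  obtains C f where "C \<in> colours G" "f \<in> C" "x \<in> f"
  using colours_Union_eq[OF assms(1)] assms(2) by blast

lemma colours_bdry:
  assumes "bcrg G" "C \<in> colours G" "f \<in> C"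
  shows "f \<in> bdry G"
  using partition_onD1[OF bcrgD(6)[OF assms(1)]] assms(2,3) by blast

lemma bdry_disjoint: "f \<in> bdry G \<Longrightarrow> g \<in> bdry G \<Longrightarrow> x \<in> f \<Longrightarrow> x \<in> g \<Longrightarrow> f = g"
  unfolding bdry_eq by (rule conn_classes_disjoint)

lemma colours_unique:
  assumes G: "bcrg G" and "C \<in> colours G" "D \<in> colours G" "x \<in> \<Union>C" "x \<in> \<Union>D"
  shows "C = D"
proof -
  obtain f g where "f \<in> C" "x \<in> f" "g \<in> D" "x \<in> g" using assms by blast
  moreover from this have "f = g"
    using colours_bdry[OF G] assms(2,3) bdry_disjoint by metis
  ultimately show ?thesis
    using disjointD[OF partition_onD2[OF bcrgD(6)[OF G]] assms(2,3)] by blast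
qed

text \<open>\<open>colour_rel\<close> is already an equivalence on the points, since each point lies
  in exactly one boundary component and this in exactly one colour class.\<close>

lemma conn_colour_rel:
  assumes G: "bcrg G" and x: "x \<in> points G"
  shows "(x, y) \<in> conn (points G) (colour_rel G) \<longleftrightarrow> (x, y) \<in> colour_rel G"
proof
  obtain C f where C: "C \<in> colours G" "f \<in> C" "x \<in> f" using colour_cases[OF G x] .
  assume "(x, y) \<in> conn (points G) (colour_rel G)"
  then show "(x, y) \<in> colour_rel G" using x
  proof (induction rule: conn_induct)
    case refl
    show ?case using C by (auto simp: colour_rel_def)
  next
    case (step y z)
    then obtain D where D: "D \<in> colours G" "x \<in> \<Union>D" "y \<in> \<Union>D" by (auto simp: colour_rel_def)
    obtain E where E: "E \<in> colours G" "y \<in> \<Union>E" "z \<in> \<Union>E"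
      using step by (auto simp: colour_rel_def)
    have "D = E" using colours_unique[OF G D(1) E(1) D(3) E(2)] .
    then show ?case using D E by (auto simp: colour_rel_def)
  qed
next
  assume "(x, y) \<in> colour_rel G"
  moreover from this have "y \<in> points G"
    using colours_Union_eq[OF G] by (auto simp: colour_rel_def)
  ultimately show "(x, y) \<in> conn (points G) (colour_rel G)" using x conn_step[of x y "colour_rel G" "points G"] by blast
qed

lemma colours_points_classes:
  assumes G: "bcrg G"
  shows "conn_classes (points G) (colour_rel G) = Union ` colours G"
proof -
  have cls: "conn (points G) (colour_rel G) `` {x} = \<Union>C" if "C \<in> colours G" "x \<in> \<Union>C" for x C
  proof -
    have "x \<in> points G" using that colours_Union_eq[OF G] by blast
    then have "conn (points G) (colour_rel G) `` {x} = colour_rel G `` {x}"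
      using conn_colour_rel[OF G] by blast
    also have "\<dots> = \<Union>C"
    proof (rule set_eqI)
      fix y
      have "D = C" if "D \<in> colours G" "x \<in> \<Union>D" for D
        using colours_unique[OF G that(1) \<open>C \<in> colours G\<close> that(2) \<open>x \<in> \<Union>C\<close>] .
      then show "y \<in> colour_rel G `` {x} \<longleftrightarrow> y \<in> \<Union>C"
        unfolding colour_rel_def using that by blast
    qed
    finally show ?thesis .
  qed
  show ?thesis
  proof (intro equalityI subsetI)
    fix X assume "X \<in> conn_classes (points G) (colour_rel G)"
    then obtain x where x: "x \<in> points G" "X = conn (points G) (colour_rel G) `` {x}"
      by (elim conn_classes_E)
    obtain C f where C: "C \<in> colours G" "f \<in> C" "x \<in> f" using colour_cases[OF G x(1)] .
    then show "X \<in> Union ` colours G" using cls[of C x] x(2) by blast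
  next
    fix X assume "X \<in> Union ` colours G"
    then obtain C where C: "C \<in> colours G" "X = \<Union>C" by blast
    have "C \<noteq> {}" using partition_onD3[OF bcrgD(6)[OF G]] C(1) by blast
    then obtain f where f: "f \<in> C" by blast
    then have "f \<in> bdry G" using colours_bdry[OF G C(1)] by blast
    then have "f \<noteq> {}" using partition_onD3[OF partition_conn_classes] by (auto simp: bdry_eq)
    then obtain x where "x \<in> f" by blast
    then have x: "x \<in> \<Union>C" using f by blast
    then have "x \<in> points G" using C colours_Union_eq[OF G] by blast
    then show "X \<in> conn_classes (points G) (colour_rel G)"
      using conn_classes_I[of x "points G" "colour_rel G"] cls[OF C(1) x] C(2) by simp
  qed
qed

lemma ncolour_empty: "ncolour G {} = card (conn_classes (points G) (colour_rel G))"
  by (simp add: ncolour_def merge_rel_def)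

lemma inj_on_Union_colours:
  assumes G: "bcrg G"
  shows "inj_on Union (colours G)"
proof (rule inj_onI)
  fix C D assume CD: "C \<in> colours G" "D \<in> colours G" "\<Union>C = \<Union>D"
  have "C \<noteq> {}" using partition_onD3[OF bcrgD(6)[OF G]] CD(1) by blast
  then obtain f where f: "f \<in> C" by blast
  then have "f \<in> bdry G" using colours_bdry[OF G CD(1)] by blast
  then have "f \<noteq> {}" using partition_onD3[OF partition_conn_classes] by (auto simp: bdry_eq)
  then obtain x where "x \<in> f" by blast
  then have "x \<in> \<Union>C" using f by blast
  then show "C = D" using colours_unique[OF G CD(1,2)] CD(3) by blast
qed

lemma card_colours:
  assumes "bcrg G"
  shows "card (colours G) = ncolour G {}"
  unfolding ncolour_empty colours_points_classes[OF assms]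
  using inj_on_Union_colours[OF assms] by (simp add: card_image)

text \<open>Links the definition by the colour graph to \<open>ncolour\<close>: sending every point
  to its colour is a quotient map, with \<open>merge_rel\<close> lying over the edges of the colour
  graph.\<close>

lemma card_mcomponents:
  assumes G: "bcrg G" and B: "B \<subseteq> edges G"
  shows "card (mcomponents (colour_graph G) B) = ncolour G B"
proof -
  define c where "c x = (THE C. C \<in> colours G \<and> x \<in> \<Union>C)" for x
  have c: "c x = C" if "C \<in> colours G" "x \<in> \<Union>C" for x C
    unfolding c_def using that colours_unique[OF G] by (intro the_equality) auto
  have c_in: "c x \<in> colours G" "x \<in> \<Union>(c x)" if "x \<in> points G" for x
    using colour_cases[OF G that] c by (metis UnionI)+
  define Q where "Q = {(u, w). \<exists>e\<in>B. u \<in> mends (colour_graph G) e \<and> w \<in> mends (colour_graph G) e}"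
  have im: "c ` points G = colours G"
  proof (intro equalityI subsetI)
    fix C assume C: "C \<in> colours G"
    then have "\<Union>C \<in> conn_classes (points G) (colour_rel G)" using colours_points_classes[OF G] by blast
    then obtain x where "x \<in> points G" "\<Union>C = conn (points G) (colour_rel G) `` {x}" by (elim conn_classes_E)
    then have "x \<in> \<Union>C" by simp
    then show "C \<in> c ` points G" using c[OF C] \<open>x \<in> points G\<close> by blast
  qed (use c_in in auto)
  have mends: "C \<in> mends (colour_graph G) e \<longleftrightarrow> C \<in> colours G \<and> \<Union>C \<inter> e \<noteq> {}" for C e
    by (auto simp: colour_graph_def)
  have "card (conn_classes (points G) (colour_rel G \<union> merge_rel B)) = card (conn_classes (colours G) Q)"
  proof (rule card_conn_classes_quotient[OF im])
    fix x y assume xy: "x \<in> points G" "y \<in> points G"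
    note cx = c_in[OF xy(1)] and cy = c_in[OF xy(2)]
    {
      assume "c x = c y"
      then have "(x, y) \<in> colour_rel G" using cx cy by (auto simp: colour_rel_def)
      then show "(x, y) \<in> conn (points G) (colour_rel G \<union> merge_rel B)"
        by (intro conn_step UnI1 xy)
    next
      assume "(x, y) \<in> colour_rel G \<union> merge_rel B"
      then show "(c x, c y) \<in> conn (colours G) Q"
      proof
        assume "(x, y) \<in> colour_rel G"
        then obtain C where "C \<in> colours G" "x \<in> \<Union>C" "y \<in> \<Union>C" by (auto simp: colour_rel_def)
        then have "c x = c y" using c[of C x] c[of C y] by simp
        then show ?thesis by simp
      next
        assume "(x, y) \<in> merge_rel B"
        then obtain e where "e \<in> B" "x \<in> e" "y \<in> e" by (auto simp: merge_rel_def)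
        moreover from this have "\<Union>(c x) \<inter> e \<noteq> {}" "\<Union>(c y) \<inter> e \<noteq> {}" using cx(2) cy(2) by blast+
        ultimately have "(c x, c y) \<in> Q" using cx(1) cy(1) unfolding Q_def by (auto simp only: mends)
        then show ?thesis using cx(1) cy(1) by (rule conn_step)
      qed
    next
      assume "(c x, c y) \<in> Q"
      then obtain e where e: "e \<in> B" "\<Union>(c x) \<inter> e \<noteq> {}" "\<Union>(c y) \<inter> e \<noteq> {}"
        unfolding Q_def by (auto simp only: mends)
      \<comment> \<open>An edge between the colours of x and y lifts to a path from x to a corner a
        by colour, to a corner b along the edge, and to y by colour.\<close>
      then obtain a b where ab: "a \<in> \<Union>(c x)" "a \<in> e" "b \<in> \<Union>(c y)" "b \<in> e" by blast
      have eP: "e \<subseteq> points G" using e(1) B ribbon_graph_edgeD(1)[OF bcrgD(1)[OF G]] by blast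
      let ?R = "colour_rel G \<union> merge_rel B"
      have "(x, a) \<in> ?R" "(a, b) \<in> ?R" "(b, y) \<in> ?R"
        using cx cy ab e(1) by (auto simp: colour_rel_def merge_rel_def)
      then have "(x, a) \<in> conn (points G) ?R" and "(a, b) \<in> conn (points G) ?R" and "(b, y) \<in> conn (points G) ?R"
        using ab(2,4) eP xy by (simp_all add: conn_step subsetD)
      then show "(x, y) \<in> conn (points G) ?R" using conn_trans[OF conn_trans] by fast
    }
  qed
  then show ?thesis by (simp add: mcomponents_def ncolour_def Q_def colour_graph_def)
qed

section \<open>Minors and edge types\<close>

lemma contract_simps [simp]:
  "points (contract G e) = points G" "arc (contract G e) = arc G" "side (contract G e) = side G"
  "edges (contract G e) = edges G - {e}" "colours (contract G e) = colours G"
  by (simp_all add: contract_def)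

lemma delete_simps [simp]:
  "points (delete G e) = points G" "arc (delete G e) = arc G" "side (delete G e) = side G"
  "seg (delete G e) = seg G" "edges (delete G e) = edges G - {e}"
  by (simp_all add: delete_def Let_def)

text \<open>Contraction stores the sides of \<open>e\<close> in \<open>seg\<close>, so at the
  corners of \<open>e\<close> the boundary follows the sides whether or not \<open>e\<close> is in
  \<open>A\<close>.\<close>

lemma nbdry_contract: "nbdry (contract G e) A = nbdry G (insert e A)"
proof -
  have "bdry_rel (contract G e) A = bdry_rel G (insert e A)"
    by (auto simp: bdry_rel_def contract_def)
  then show ?thesis by (simp add: nbdry_def)
qed

lemma ncolour_contract: "ncolour (contract G e) B = ncolour G B"
  by (simp add: ncolour_def colour_rel_def)

lemma nbdry_delete: "nbdry (delete G e) A = nbdry G A"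
  by (simp add: nbdry_def bdry_rel_def)

text \<open>All cases of the deletion rule are treated at once. The components meeting
  \<open>e\<close> cover the same points before and after deletion, so the new class
  \<open>N\<close> covers exactly the old colour classes found at \<open>e\<close>; putting
  \<open>e\<close> into \<open>merge_rel\<close> has the same effect.\<close>

lemma ncolour_delete:
  assumes G: "bcrg G" and e: "e \<in> edges G"
  shows "ncolour (delete G e) B = ncolour G (insert e B)"
proof -
  define T where "T = {a \<in> bdry G. a \<inter> e \<noteq> {}}"
  define R where "R = {r \<in> bdry (G\<lparr>edges := edges G - {e}\<rparr>). r \<inter> e \<noteq> {}}"
  define N where "N = (\<Union>{C \<in> colours G. C \<inter> T \<noteq> {}} - T) \<union> R"
  have cols: "colours (delete G e) = {C \<in> colours G. C \<inter> T = {}} \<union> {N}"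
    by (simp add: delete_def Let_def T_def R_def N_def)
  have bd': "bdry (G\<lparr>edges := edges G - {e}\<rparr>) = conn_classes (points G) (bdry_rel G (edges G - {e}))"
    by (simp add: bdry_eq) (simp add: bdry_rel_def)
  have eP: "e \<subseteq> points G" using ribbon_graph_edgeD(1)[OF bcrgD(1)[OF G] e] .
  have TR: "\<Union>T = \<Union>R"
    unfolding T_def R_def bd' bdry_eq[of G]
    by (rule Union_conn_classes_meeting, rule bdry_rel_agree[OF bcrgD(1)[OF G] e]) auto
  have eT: "e \<subseteq> \<Union>T"
  proof
    fix x assume x: "x \<in> e"
    then have "x \<in> \<Union>(bdry G)" using eP by (auto simp: bdry_eq)
    then show "x \<in> \<Union>T" using x unfolding T_def by blast
  qed
  \<comment> \<open>Every point of the new class shares an old colour with some corner of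
    \<open>e\<close>; \<open>new\<close> below is the converse inclusion.\<close>
  have old: "\<exists>z\<in>e. (x, z) \<in> colour_rel G" if xN: "x \<in> \<Union>N" for x
  proof -
    have "\<exists>C\<in>colours G. C \<inter> T \<noteq> {} \<and> x \<in> \<Union>C"
    proof (cases "x \<in> \<Union>T")
      case True
      then obtain a where a: "a \<in> T" "x \<in> a" by blast
      then have "a \<in> \<Union>(colours G)" using partition_onD1[OF bcrgD(6)[OF G]] unfolding T_def by blast
      then show ?thesis using a by blast
    next
      case False
      obtain r where r: "r \<in> N" "x \<in> r" using xN by blast
      then have "r \<notin> R" using False unfolding TR by blast
      then obtain C where "C \<in> colours G" "C \<inter> T \<noteq> {}" "r \<in> C" using r(1) unfolding N_def by blast
      then show ?thesis using r(2) by blast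
    qed
    then show ?thesis unfolding colour_rel_def T_def by blast
  qed
  have new: "x \<in> \<Union>N" if C: "x \<in> \<Union>C" "C \<in> colours G" "C \<inter> T \<noteq> {}" for x C
  proof (cases "x \<in> \<Union>T")
    case True
    then have "x \<in> \<Union>R" unfolding TR .
    then show ?thesis unfolding N_def by blast
  next
    case False
    obtain f where f: "f \<in> C" "x \<in> f" using C(1) by blast
    then have "f \<in> N" using False C(2,3) unfolding N_def by blast
    then show ?thesis using f(2) by blast
  qed
  let ?R' = "colour_rel (delete G e) \<union> merge_rel B" and ?R = "colour_rel G \<union> merge_rel (insert e B)"
  have "conn_classes (points G) ?R' = conn_classes (points G) ?R"
  proof (rule conn_classes_eqI)
    fix x y assume xy: "(x, y) \<in> ?R'" "x \<in> points G" "y \<in> points G"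
    show "(x, y) \<in> conn (points G) ?R"
    proof (cases "(x, y) \<in> ?R")
      case True
      then show ?thesis using xy(2,3) by (rule conn_step)
    next
      case False
      then have "x \<in> \<Union>N" "y \<in> \<Union>N"
        using xy(1) cols by (auto simp: colour_rel_def merge_rel_def)
      then obtain z w where zw: "z \<in> e" "(x, z) \<in> ?R" "w \<in> e" "(y, w) \<in> ?R"
        using old[of x] old[of y] by blast
      then have "(z, w) \<in> ?R" by (auto simp: merge_rel_def)
      then have "(x, z) \<in> conn (points G) ?R" "(z, w) \<in> conn (points G) ?R"
        "(y, w) \<in> conn (points G) ?R"
        using zw eP xy(2,3) by (simp_all add: conn_step subsetD)
      from conn_trans[OF conn_trans[OF this(1,2)] conn_sym[OF this(3)]] show ?thesis .
    qed
  next
    fix x y assume xy: "(x, y) \<in> ?R" "x \<in> points G" "y \<in> points G"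
    then consider C where "C \<in> colours G" "x \<in> \<Union>C" "y \<in> \<Union>C" | "x \<in> e" "y \<in> e" | "(x, y) \<in> merge_rel B"
      by (auto simp: colour_rel_def merge_rel_def)
    then have "(x, y) \<in> ?R'"
    proof cases
      case 1
      then show ?thesis
        using new[OF 1(2,1)] new[OF 1(3,1)] unfolding colour_rel_def cols by (cases "C \<inter> T = {}") auto
    next
      case 2
      then have "x \<in> \<Union>R" "y \<in> \<Union>R" using eT unfolding TR by auto
      then have "x \<in> \<Union>N" "y \<in> \<Union>N" unfolding N_def by auto
      then show ?thesis unfolding colour_rel_def cols by blast
    qed blast
    then show "(x, y) \<in> conn (points G) ?R'" using xy(2,3) by (rule conn_step)
  qed
  then show ?thesis by (simp add: ncolour_def)
qed

lemma minor_closedD: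
  assumes "minor_closed \<G>" "G \<in> \<G>"
  shows "bcrg G" "bcrg H \<Longrightarrow> equivalent G H \<Longrightarrow> H \<in> \<G>"
    "e \<in> edges G \<Longrightarrow> delete G e \<in> \<G>" "e \<in> edges G \<Longrightarrow> contract G e \<in> \<G>"
  using assms unfolding minor_closed_def by blast+

lemma enumeration:
  assumes "finite A"
  shows "distinct (enumeration A)" "set (enumeration A) = A"
  using someI_ex[of "\<lambda>xs. distinct xs \<and> set xs = A"] finite_distinct_list[OF assms]
  unfolding enumeration_def by blast+

section \<open>Deleting or contracting several edges\<close>

lemma delete_list:
  assumes M: "minor_closed \<G>" and G: "G \<in> \<G>" and "distinct xs" "set xs \<subseteq> edges G"
  shows "foldl delete G xs \<in> \<G>" "edges (foldl delete G xs) = edges G - set xs"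
    "nbdry (foldl delete G xs) A = nbdry G A" "ncolour (foldl delete G xs) B = ncolour G (set xs \<union> B)"
proof -
  \<comment> \<open>The part on \<open>ncolour\<close> is quantified over \<open>B\<close>, because
    the last deletion replaces \<open>B\<close> by \<open>insert e B\<close> before the induction
    hypothesis is used. For contraction the roles of \<open>A\<close> and \<open>B\<close> are
    exchanged.\<close>
  have "foldl delete G xs \<in> \<G> \<and> edges (foldl delete G xs) = edges G - set xs \<and>
    nbdry (foldl delete G xs) A = nbdry G A \<and>
    (\<forall>B. ncolour (foldl delete G xs) B = ncolour G (set xs \<union> B))"
    using assms(3,4)
  proof (induction xs rule: rev_induct)
    case (snoc e xs)
    let ?H = "foldl delete G xs"
    have H: "?H \<in> \<G>" "edges ?H = edges G - set xs" "nbdry ?H A = nbdry G A"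
      and c: "\<And>B. ncolour ?H B = ncolour G (set xs \<union> B)"
      using snoc by auto
    have e: "e \<in> edges ?H" using snoc.prems H(2) by auto
    show ?case
      using minor_closedD(3)[OF M H(1) e] H(2,3) ncolour_delete[OF minor_closedD(1)[OF M H(1)] e]
      by (auto simp: c nbdry_delete)
  qed (use G in simp)
  then show "foldl delete G xs \<in> \<G>" "edges (foldl delete G xs) = edges G - set xs"
    "nbdry (foldl delete G xs) A = nbdry G A" "ncolour (foldl delete G xs) B = ncolour G (set xs \<union> B)"
    by blast+
qed

lemma contract_list:
  assumes M: "minor_closed \<G>" and G: "G \<in> \<G>" and "distinct xs" "set xs \<subseteq> edges G"
  shows "foldl contract G xs \<in> \<G>" "edges (foldl contract G xs) = edges G - set xs"
    "nbdry (foldl contract G xs) A = nbdry G (set xs \<union> A)" "ncolour (foldl contract G xs) B = ncolour G B"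
proof -
  have "foldl contract G xs \<in> \<G> \<and> edges (foldl contract G xs) = edges G - set xs \<and>
    (\<forall>A. nbdry (foldl contract G xs) A = nbdry G (set xs \<union> A)) \<and>
    ncolour (foldl contract G xs) B = ncolour G B"
    using assms(3,4)
  proof (induction xs rule: rev_induct)
    case (snoc e xs)
    let ?H = "foldl contract G xs"
    have H: "?H \<in> \<G>" "edges ?H = edges G - set xs" "ncolour ?H B = ncolour G B"
      and c: "\<And>A. nbdry ?H A = nbdry G (set xs \<union> A)"
      using snoc by auto
    have e: "e \<in> edges ?H" using snoc.prems H(2) by auto
    show ?case
      using minor_closedD(4)[OF M H(1) e] H(2,3)
      by (auto simp: c nbdry_contract ncolour_contract)
  qed (use G in simp)
  then show "foldl contract G xs \<in> \<G>" "edges (foldl contract G xs) = edges G - set xs"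
    "nbdry (foldl contract G xs) A = nbdry G (set xs \<union> A)" "ncolour (foldl contract G xs) B = ncolour G B"
    by blast+
qed

section \<open>The type of an edge as a record of increments\<close>

text \<open>Describes the classes that survive \<open>remove_isolated\<close> when \<open>e\<close>
  is the only edge, both for vertices and for boundary components.\<close>

lemma conn_classes_Union_meeting:
  assumes "e \<subseteq> S" "Q = \<Union>{C \<in> conn_classes S R. C \<inter> e \<noteq> {}}"
  shows "conn_classes Q R = {C \<in> conn_classes S R. C \<inter> e \<noteq> {}}"
proof -
  let ?M = "{C \<in> conn_classes S R. C \<inter> e \<noteq> {}}"
  have "conn_classes Q R = {C \<in> conn_classes S R. C \<subseteq> Q}"
  proof (rule conn_classes_restrict)
    show "Q \<subseteq> S" using assms(2) conn_classes_mem(2)[of _ S R] by blast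
    fix x y assume "x \<in> Q" and xy: "(x, y) \<in> conn S R"
    then obtain C where "C \<in> ?M" "x \<in> C" using assms(2) by blast
    then show "y \<in> Q" using conn_classes_closed[of C S R x y] xy assms(2) by blast
  qed
  also have "\<dots> = ?M"
  proof (intro equalityI subsetI)
    fix C assume C: "C \<in> {C \<in> conn_classes S R. C \<subseteq> Q}"
    then have "C \<noteq> {}" using partition_onD3[OF partition_conn_classes] by blast
    then obtain x where x: "x \<in> C" by blast
    then obtain D where D: "D \<in> ?M" "x \<in> D" using C assms(2) by blast
    then have "C = D" using conn_classes_disjoint[of C S R D x] x C by simp
    then show "C \<in> ?M" using D by simp
  qed (use assms(2) in blast)
  finally show ?thesis .
qed

text \<open>Number of vertices minus number of boundary components of the one-edge graph.\<close>

fun type_excess :: "etype \<Rightarrow> int" where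
  "type_excess Type_b = 1"
| "type_excess Type_nl = 0"
| "type_excess Type_olc = - 1"
| "type_excess Type_olh = - 1"

text \<open>Number of colour classes lost when the colours at the edge are merged.\<close>

fun type_merge :: "etype \<Rightarrow> int" where
  "type_merge Type_olc = 1"
| "type_merge _ = 0"

lemma image_eq_singleton: "A \<noteq> {} \<Longrightarrow> (\<And>x. x \<in> A \<Longrightarrow> f x = c) \<Longrightarrow> f ` A = {c}"
  by auto

text \<open>Classes avoiding \<open>e\<close> are the same with and without the edge, so both
  differences only count classes meeting \<open>e\<close>. The vertex and boundary counts come from
  the trichotomy. The colour count is 1 if one boundary component meets \<open>e\<close>; for two
  components it depends on whether they share a colour.\<close>

lemma single_edge:
  assumes H: "bcrg H" and e: "edges H = {e}"
  shows single_edge_type: "\<exists>t. is_single_edge (remove_isolated H) t"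
    and single_edge_counts: "\<And>t. is_single_edge (remove_isolated H) t \<Longrightarrow>
      int (nbdry H {}) - int (nbdry H {e}) = type_excess t \<and>
      int (ncolour H {}) - int (ncolour H {e}) = type_merge t"
proof -
  note HD = bcrgD[OF H]
  have eH: "e \<in> edges H" using e by simp
  note eD = ribbon_graph_edgeD[OF HD(1) eH]
  interpret two_matchings "points H" "arc H" "seg H" e
    using HD(2-4) eD(1) fpf_involution_onD(1)[OF eD(3)] by unfold_locales auto
  have rel0: "step_rel (arc H) (seg H) UNIV = bdry_rel H {}"
    by (auto simp: step_rel_def bdry_rel_def)
  have rel1: "off \<union> {(x, side H x) |x. x \<in> e} = bdry_rel H {e}"
    by (auto simp: step_rel_def bdry_rel_def)
  define V where "V = {C \<in> conn_classes (points H) (bdry_rel H {}). C \<inter> e \<noteq> {}}"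
  define F where "F = {C \<in> conn_classes (points H) (bdry_rel H {e}). C \<inter> e \<noteq> {}}"
  define Q where "Q = \<Union>V"
  define H' where "H' = remove_isolated H"
  have agree: "(a, b) \<in> bdry_rel H {} \<longleftrightarrow> (a, b) \<in> bdry_rel H {e}" if "a \<notin> e \<or> b \<notin> e" for a b
    by (rule bdry_rel_agree[OF HD(1) eH _ _ _ that]) (auto simp: e)
  \<comment> \<open>The points kept by \<open>remove_isolated\<close> are also those of the boundary
    components meeting \<open>e\<close>, so just these components survive.\<close>
  have QF: "Q = \<Union>F" unfolding Q_def V_def F_def by (rule Union_conn_classes_meeting) (rule agree)
  have "{C \<in> conn_classes (points H) (bdry_rel H {}). C \<inter> e = {}}
    = {C \<in> conn_classes (points H) (bdry_rel H {e}). C \<inter> e = {}}"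
    by (rule conn_classes_off) (rule agree)
  then have excess: "int (nbdry H {}) - int (nbdry H {e}) = int (card V) - int (card F)"
    unfolding nbdry_def V_def F_def
    using card_conn_classes_split[OF HD(2), of "bdry_rel H {}" e]
      card_conn_classes_split[OF HD(2), of "bdry_rel H {e}" e] by simp
  have H'_simps: "points H' = Q" "arc H' = arc H" "seg H' = seg H" "side H' = side H" "edges H' = {e}"
    "colours H' = (\<lambda>C. {a \<in> C. a \<subseteq> Q}) ` colours H - {{}}"
    by (simp_all add: H'_def remove_isolated_def Let_def e Q_def V_def verts_eq)
  have relH': "bdry_rel H' = bdry_rel H" by (rule ext) (simp add: bdry_rel_def H'_simps)
  have vertsH': "verts H' = V"
    unfolding verts_eq relH' H'_simps(1)
    using conn_classes_Union_meeting[OF eD(1), of Q "bdry_rel H {}"] by (simp add: Q_def V_def)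
  have bdryH': "bdry H' = F"
    unfolding bdry_eq relH' H'_simps(1,5)
    using conn_classes_Union_meeting[OF eD(1), of Q "bdry_rel H {e}"] QF by (simp add: F_def)
  have tri: "card V = 2 \<and> card F = 1 \<or> card V = 1 \<and> card F = 2 \<and> orientable H'
    \<or> card V = 1 \<and> card F = 1 \<and> \<not> orientable H'"
    using single_edge_trichotomy[OF eD(4) eD(5) eD(2), unfolded rel0 rel1]
    by (simp add: V_def F_def orientable_def H'_simps Q_def)
  \<comment> \<open>The number of colour classes found at the corners of \<open>e\<close>. Merging
    along \<open>e\<close> turns them into one, hence the difference \<open>m - 1\<close>
    below.\<close>
  define m where "m = card {C \<in> conn_classes (points H) (colour_rel H). C \<inter> e \<noteq> {}}"
  have ene: "e \<noteq> {}" using eD(2) by auto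
  have "{C \<in> conn_classes (points H) (colour_rel H). C \<inter> e = {}}
    = {C \<in> conn_classes (points H) (colour_rel H \<union> merge_rel {e}). C \<inter> e = {}}"
    by (rule conn_classes_off) (auto simp: merge_rel_def)
  moreover have "card {C \<in> conn_classes (points H) (colour_rel H \<union> merge_rel {e}). C \<inter> e \<noteq> {}} = 1"
  proof -
    obtain p where p: "p \<in> e" using ene by blast
    let ?R = "colour_rel H \<union> merge_rel {e}"
    have "conn (points H) ?R `` {x} = conn (points H) ?R `` {p}" if "x \<in> e" for x
      by (rule conn_class_eq, rule conn_step) (use that p eD(1) in \<open>auto simp: merge_rel_def\<close>)
    with ene have "(\<lambda>x. conn (points H) ?R `` {x}) ` e = {conn (points H) ?R `` {p}}"
      by (rule image_eq_singleton)
    then show ?thesis unfolding conn_classes_meeting[OF eD(1)] by simp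
  qed
  ultimately have merge: "int (ncolour H {}) - int (ncolour H {e}) = int m - 1"
    unfolding ncolour_empty ncolour_def[of H "{e}"] m_def
    using card_conn_classes_split[OF HD(2), of "colour_rel H" e]
      card_conn_classes_split[OF HD(2), of "colour_rel H \<union> merge_rel {e}" e] by simp
  have bdryH: "bdry H = conn_classes (points H) (bdry_rel H {e})" by (simp add: bdry_eq e)
  have Fb: "f \<in> bdry H" "f \<subseteq> Q" if "f \<in> F" for f using that QF unfolding bdryH F_def by auto
  have rel: "conn (points H) (colour_rel H) `` {x} = conn (points H) (colour_rel H) `` {y} \<longleftrightarrow>
      (\<exists>C\<in>colours H. f \<in> C \<and> g \<in> C)"
    if fg: "f \<in> F" "g \<in> F" and xy: "x \<in> e" "x \<in> f" "y \<in> e" "y \<in> g" for f g x y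
  proof -
    have "x \<in> points H" using xy eD(1) by blast
    then have "conn (points H) (colour_rel H) `` {x} = conn (points H) (colour_rel H) `` {y} \<longleftrightarrow> (x, y) \<in> colour_rel H"
      unfolding conn_class_eq_iff by (rule conn_colour_rel[OF H])
    also have "\<dots> \<longleftrightarrow> (\<exists>C\<in>colours H. f \<in> C \<and> g \<in> C)"
    proof
      assume "(x, y) \<in> colour_rel H"
      then obtain C f' g' where C: "C \<in> colours H" "f' \<in> C" "x \<in> f'" "g' \<in> C" "y \<in> g'"
        by (auto simp: colour_rel_def)
      have "f' = f" "g' = g"
        using bdry_disjoint[OF colours_bdry[OF H C(1,2)] Fb(1)[OF fg(1)] C(3) xy(2)]
          bdry_disjoint[OF colours_bdry[OF H C(1,4)] Fb(1)[OF fg(2)] C(5) xy(4)] by auto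
      then show "\<exists>C\<in>colours H. f \<in> C \<and> g \<in> C" using C by blast
    qed (use xy in \<open>auto simp: colour_rel_def\<close>)
    finally show ?thesis .
  qed
  have e_F: "\<exists>f\<in>F. x \<in> f" if "x \<in> e" for x
  proof -
    have "x \<in> \<Union>(bdry H)" using that eD(1) by (auto simp: bdryH)
    then show ?thesis using that unfolding F_def bdryH by blast
  qed
  have self: "\<exists>C\<in>colours H. f \<in> C \<and> f \<in> C" if "f \<in> F" for f
    using Fb(1)[OF that] partition_onD1[OF HD(6)] by blast
  have m1: "m = 1" if F1: "card F = 1"
  proof -
    obtain f where f: "F = {f}" using F1 by (auto simp: card_1_singleton_iff)
    obtain p where p: "p \<in> e" using ene by blast
    have "conn (points H) (colour_rel H) `` {x} = conn (points H) (colour_rel H) `` {p}" if "x \<in> e" for x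
      using rel[of f f x p] self[of f] e_F[OF that] e_F[OF p] that p f by simp
    with ene have "(\<lambda>x. conn (points H) (colour_rel H) `` {x}) ` e = {conn (points H) (colour_rel H) `` {p}}"
      by (rule image_eq_singleton)
    then show ?thesis unfolding m_def conn_classes_meeting[OF eD(1)] by simp
  qed
  have m2: "m = (if \<exists>C\<in>colours H. f \<in> C \<and> g \<in> C then 1 else 2)" if F: "F = {f, g}" "f \<noteq> g" for f g
  proof -
    have fg: "f \<in> F" "g \<in> F" using F(1) by simp_all
    then have "f \<inter> e \<noteq> {}" "g \<inter> e \<noteq> {}" by (simp_all add: F_def)
    then obtain x y where xy: "x \<in> e" "x \<in> f" "y \<in> e" "y \<in> g" by blast
    let ?c = "\<lambda>x. conn (points H) (colour_rel H) `` {x}"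
    have "?c z = ?c x \<or> ?c z = ?c y" if z: "z \<in> e" for z
    proof -
      consider "z \<in> f" | "z \<in> g" using e_F[OF z] F(1) by blast
      then show ?thesis
      proof cases
        case 1
        show ?thesis using rel[OF fg(1,1) z 1 xy(1,2)] self[OF fg(1)] by blast
      next
        case 2
        show ?thesis using rel[OF fg(2,2) z 2 xy(3,4)] self[OF fg(2)] by blast
      qed
    qed
    then have "?c ` e \<subseteq> {?c x, ?c y}" by blast
    moreover have "{?c x, ?c y} \<subseteq> ?c ` e" using xy by blast
    ultimately have "?c ` e = {?c x, ?c y}" by (rule equalityI)
    moreover have "card {a, b} = (if a = b then 1 else 2)" for a b :: "'a set" by simp
    moreover have "?c x = ?c y \<longleftrightarrow> (\<exists>C\<in>colours H. f \<in> C \<and> g \<in> C)"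
      using rel[OF fg xy] .
    ultimately show ?thesis
      unfolding m_def conn_classes_meeting[OF eD(1)] by presburger
  qed
  \<comment> \<open>Both components lie in \<open>Q\<close>, so trimming the colour classes to
    \<open>Q\<close> preserves whether they share a class.\<close>
  have same: "(\<exists>C\<in>colours H'. f \<in> C \<and> g \<in> C) \<longleftrightarrow> (\<exists>C\<in>colours H. f \<in> C \<and> g \<in> C)"
    if "F = {f, g}" for f g
  proof
    assume "\<exists>C\<in>colours H. f \<in> C \<and> g \<in> C"
    then obtain C where C: "C \<in> colours H" "f \<in> C" "g \<in> C" by blast
    moreover have "f \<subseteq> Q" "g \<subseteq> Q" using that Fb(2) by simp_all
    ultimately have "f \<in> {a \<in> C. a \<subseteq> Q}" "g \<in> {a \<in> C. a \<subseteq> Q}" by simp_all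
    moreover from this have "{a \<in> C. a \<subseteq> Q} \<in> colours H'" using C(1) unfolding H'_simps(6) by blast
    ultimately show "\<exists>C\<in>colours H'. f \<in> C \<and> g \<in> C" by (intro bexI conjI)
  qed (auto simp: H'_simps(6))
  have cE: "card (edges H') = 1" by (simp add: H'_simps)
  show "\<exists>t. is_single_edge (remove_isolated H) t"
  proof (cases "card V = 2")
    case True
    then have "is_single_edge H' Type_b" by (simp add: cE vertsH')
    then show ?thesis unfolding H'_def ..
  next
    case False
    show ?thesis
    proof (cases "orientable H'")
      case True
      then obtain f g where F: "F = {f, g}" "f \<noteq> g" using tri False by (auto simp: card_2_iff)
      have "is_single_edge H' (if \<exists>C\<in>colours H'. f \<in> C \<and> g \<in> C then Type_olh else Type_olc)"
        using tri False True F by (auto simp: cE vertsH' bdryH')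
      then show ?thesis unfolding H'_def ..
    next
      case no: False
      then have "is_single_edge H' Type_nl" using tri False by (auto simp: cE vertsH')
      then show ?thesis unfolding H'_def ..
    qed
  qed
  fix t assume t: "is_single_edge (remove_isolated H) t"
  then have t: "is_single_edge H' t" by (simp add: H'_def)
  show "int (nbdry H {}) - int (nbdry H {e}) = type_excess t \<and>
      int (ncolour H {}) - int (ncolour H {e}) = type_merge t"
    unfolding excess merge
  proof (cases t)
    case Type_b
    then show "int (card V) - int (card F) = type_excess t \<and> int m - 1 = type_merge t"
      using t tri m1 by (simp add: vertsH')
  next
    case Type_nl
    then show "int (card V) - int (card F) = type_excess t \<and> int m - 1 = type_merge t"
      using t tri m1 by (auto simp: vertsH')
  next
    case Type_olc
    then obtain f g where F: "F = {f, g}" "f \<noteq> g" and n: "\<not> (\<exists>C\<in>colours H'. f \<in> C \<and> g \<in> C)"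
      and "card V = 1" using t by (auto simp: vertsH' bdryH')
    then have "m = 2" "card F = 2" using m2[OF F] same[OF F(1)] by auto
    then show "int (card V) - int (card F) = type_excess t \<and> int m - 1 = type_merge t"
      using Type_olc \<open>card V = 1\<close> by simp
  next
    case Type_olh
    then obtain f g where F: "F = {f, g}" "f \<noteq> g" and n: "\<exists>C\<in>colours H'. f \<in> C \<and> g \<in> C"
      and "card V = 1" using t by (auto simp: vertsH' bdryH')
    then have "m = 1" "card F = 2" using m2[OF F] same[OF F(1)] by auto
    then show "int (card V) - int (card F) = type_excess t \<and> int m - 1 = type_merge t"
      using Type_olh \<open>card V = 1\<close> by simp
  qed
qed

text \<open>Contracting the other edges puts them into every argument of \<open>nbdry\<close> and
  leaves \<open>ncolour\<close> alone; deleting them does the opposite. So \<open>i\<close> records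
  the increment of \<open>nbdry\<close> at the top and of \<open>ncolour\<close> at the bottom of
  the subset lattice, and \<open>j\<close> the reverse.\<close>

lemma edge_type:
  assumes M: "minor_closed \<G>" and G: "G \<in> \<G>" and e: "e \<in> edges G"
  shows edge_type_exists: "\<exists>i j. edge_type G e i j"
    and edge_type_counts: "\<And>i j. edge_type G e i j \<Longrightarrow>
      int (nbdry G (edges G - {e})) - int (nbdry G (edges G)) = type_excess i \<and>
      int (ncolour G {}) - int (ncolour G {e}) = type_merge i \<and>
      int (nbdry G {}) - int (nbdry G {e}) = type_excess j \<and>
      int (ncolour G (edges G - {e})) - int (ncolour G (edges G)) = type_merge j"
proof -
  let ?A = "edges G - {e}"
  have fin: "finite ?A" using finite_edges[OF bcrgD(1)[OF minor_closedD(1)[OF M G]]] by simp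
  note en = enumeration[OF fin]
  have sub: "set (enumeration ?A) \<subseteq> edges G" using en(2) by blast
  have ed: "edges G - ?A = {e}" "insert e ?A = edges G" "?A \<union> {e} = edges G" using e by auto
  note C = contract_list[OF M G en(1) sub, unfolded en(2) ed(1), folded contract_all_def]
  note D = delete_list[OF M G en(1) sub, unfolded en(2) ed(1), folded delete_all_def]
  note sC = single_edge[OF minor_closedD(1)[OF M C(1)] C(2)]
  note sD = single_edge[OF minor_closedD(1)[OF M D(1)] D(2)]
  show "\<exists>i j. edge_type G e i j" using sC(1) sD(1) by (auto simp: edge_type_def)
  fix i j assume "edge_type G e i j"
  then show "int (nbdry G (edges G - {e})) - int (nbdry G (edges G)) = type_excess i \<and>
      int (ncolour G {}) - int (ncolour G {e}) = type_merge i \<and>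
      int (nbdry G {}) - int (nbdry G {e}) = type_excess j \<and>
      int (ncolour G (edges G - {e})) - int (ncolour G (edges G)) = type_merge j"
    using sC(2)[of i] sD(2)[of j] by (simp add: edge_type_def C(3,4) D(3,4) ed insert_absorb[OF e])
qed

section \<open>Invariance under equivalence\<close>

lemma card_conn_classes_iso:
  assumes k: "bij_betw k S T" and RQ: "\<And>x y. x \<in> S \<Longrightarrow> y \<in> S \<Longrightarrow> (x, y) \<in> R \<longleftrightarrow> (k x, k y) \<in> Q"
  shows "card (conn_classes S R) = card (conn_classes T Q)"
proof (rule card_conn_classes_quotient)
  show im: "k ` S = T" using k by (simp add: bij_betw_def)
  fix x y assume xy: "x \<in> S" "y \<in> S"
  show "k x = k y \<Longrightarrow> (x, y) \<in> conn S R"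
    using inj_on_eq_iff[OF bij_betw_imp_inj_on[OF k] xy] by simp
  show "(x, y) \<in> R \<Longrightarrow> (k x, k y) \<in> conn T Q"
    using xy im RQ[OF xy] by (intro conn_step) auto
  show "(k x, k y) \<in> Q \<Longrightarrow> (x, y) \<in> conn S R"
    using xy RQ[OF xy] by (intro conn_step) auto
qed

definition free_rel :: "('a, 'z) ribbon_graph_scheme \<Rightarrow> 'a rel" where
  "free_rel G = {(p, arc G p) |p. True} \<union> {(p, seg G p) |p. p \<notin> \<Union>(edges G)}"

lemma free_arcs_eq: "free_arcs G = conn_classes (points G) (free_rel G)"
  by (simp add: free_arcs_def free_rel_def)

definition free_class :: "('a, 'z) ribbon_graph_scheme \<Rightarrow> 'a \<Rightarrow> 'a set" where
  "free_class G x = conn (points G) (free_rel G) `` {x}"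

lemma free_class_image: "free_class G ` points G = free_arcs G"
  by (auto simp: free_class_def free_arcs_eq conn_classes_conn quotient_def)

lemma free_class_self: "x \<in> free_class G x"
  by (simp add: free_class_def)

lemma free_class_eq_iff: "free_class G x = free_class G y \<longleftrightarrow> (x, y) \<in> conn (points G) (free_rel G)"
  unfolding free_class_def by (rule conn_class_eq_iff)

lemma free_classD:
  assumes "x \<in> points G" "p \<in> free_class G x"
  shows "p \<in> points G" "free_class G x = free_class G p"
proof -
  have c: "(x, p) \<in> conn (points G) (free_rel G)" using assms(2) by (simp add: free_class_def)
  show "p \<in> points G" using conn_in[OF c assms(1)] .
  show "free_class G x = free_class G p" using c unfolding free_class_eq_iff .
qed

text \<open>How the boundary of the subgraph with edge set \<open>A\<close> continues at an edge
  corner where a free arc ends: along the side of a present edge, across the segment of an absent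
  one.\<close>

definition corner_step :: "('a, 'z) ribbon_graph_scheme \<Rightarrow> 'a set set \<Rightarrow> 'a \<Rightarrow> 'a" where
  "corner_step G A p = (if p \<in> \<Union>A then side G p else seg G p)"

lemma bdry_rel_iff: "(x, y) \<in> bdry_rel G A \<longleftrightarrow> y = arc G x \<or> y = corner_step G A x"
  by (cases "x \<in> \<Union>A") (simp_all add: bdry_rel_def corner_step_def del: Union_iff)

lemma free_rel_iff: "(x, y) \<in> free_rel G \<longleftrightarrow> y = arc G x \<or> x \<notin> \<Union>(edges G) \<and> y = seg G x"
  by (auto simp add: free_rel_def simp del: Union_iff)

lemma corner_step_in:
  assumes "ribbon_graph G" "p \<in> \<Union>(edges G)"
  shows "corner_step G A p \<in> \<Union>(edges G)"
proof -
  obtain e where e: "e \<in> edges G" "p \<in> e" using assms(2) by blast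
  note eD = ribbon_graph_edgeD(3,4)[OF assms(1) e(1)]
  have "seg G p \<in> e" "side G p \<in> e" using fpf_involution_onD(1)[OF eD(1) e(2)] fpf_involution_onD(1)[OF eD(2) e(2)] .
  then show ?thesis using e(1) by (auto simp: corner_step_def)
qed

text \<open>An equivalence only sees corners and free arcs, so the count is expressed through these.
  Steps inside a free arc are boundary steps for every \<open>A\<close>, and every other boundary
  step is a \<open>corner_step\<close> at an edge corner.\<close>

lemma nbdry_free_arcs:
  assumes G: "ribbon_graph G" and A: "A \<subseteq> edges G"
  shows "nbdry G A = card (conn_classes (free_arcs G)
    {(s, t). \<exists>p\<in>\<Union>(edges G). p \<in> s \<and> corner_step G A p \<in> t})"
  unfolding nbdry_def
proof (rule card_conn_classes_quotient[OF free_class_image])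
  let ?Q = "{(s, t). \<exists>p\<in>\<Union>(edges G). p \<in> s \<and> corner_step G A p \<in> t}"
  let ?R = "bdry_rel G A"
  have off: "p \<notin> \<Union>A" if "p \<notin> \<Union>(edges G)" for p using that A by blast
  have sub: "free_rel G \<subseteq> ?R" unfolding free_rel_def bdry_rel_def using off by blast
  fix x y assume x: "x \<in> points G" and y: "y \<in> points G"
  show fib: "(x, y) \<in> conn (points G) ?R" if "free_class G x = free_class G y" for x y
    using that sub unfolding free_class_eq_iff by (rule conn_mono)
  show "(free_class G x, free_class G y) \<in> conn (free_arcs G) ?Q" if xy: "(x, y) \<in> ?R"
  proof (cases "x \<in> \<Union>(edges G) \<and> y = corner_step G A x")
    case True
    then have "(free_class G x, free_class G y) \<in> ?Q" using free_class_self[of x G] free_class_self[of y G] by auto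
    then show ?thesis by (rule conn_step) (use x y free_class_image[of G] in blast)+
  next
    case False
    then have "(x, y) \<in> free_rel G"
      using xy off[of x] False unfolding bdry_rel_iff free_rel_iff corner_step_def by metis
    then have "free_class G x = free_class G y"
      unfolding free_class_eq_iff using x y by (rule conn_step)
    then show ?thesis by simp
  qed
  show "(x, y) \<in> conn (points G) ?R" if "(free_class G x, free_class G y) \<in> ?Q"
  proof -
    obtain p where p: "p \<in> free_class G x" "corner_step G A p \<in> free_class G y"
      using \<open>(free_class G x, free_class G y) \<in> ?Q\<close> by blast
    note px = free_classD[OF x p(1)] and py = free_classD[OF y p(2)]
    have "(p, corner_step G A p) \<in> ?R" by (simp add: bdry_rel_iff)
    then have "(p, corner_step G A p) \<in> conn (points G) ?R" using px(1) py(1) by (rule conn_step)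
    from conn_trans[OF conn_trans[OF fib[OF px(2)] this] fib[OF py(2)[symmetric]]] show ?thesis .
  qed
qed

text \<open>A free arc lies within a single boundary component, so one of its points determines its
  colour.\<close>

lemma free_class_bdry:
  assumes "bcrg G" "x \<in> points G" "C \<in> colours G"
  shows "free_class G x \<subseteq> \<Union>C \<longleftrightarrow> x \<in> \<Union>C"
proof
  assume "x \<in> \<Union>C"
  then obtain f where f: "f \<in> C" "x \<in> f" by blast
  have fb: "f \<in> conn_classes (points G) (bdry_rel G (edges G))"
    using colours_bdry[OF assms(1,3) f(1)] by (simp add: bdry_eq)
  have "free_class G x \<subseteq> f"
  proof
    fix y assume "y \<in> free_class G x"
    then have "(x, y) \<in> conn (points G) (free_rel G)" by (simp add: free_class_def)
    then have "(x, y) \<in> conn (points G) (bdry_rel G (edges G))"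
      by (rule conn_mono) (auto simp: free_rel_def bdry_rel_def)
    then show "y \<in> f" by (rule conn_classes_closed[OF fb f(2)])
  qed
  then show "free_class G x \<subseteq> \<Union>C" using f(1) by blast
qed (use free_class_self[of x G] in blast)

lemma ncolour_free_arcs:
  assumes G: "bcrg G"
  shows "ncolour G B = card (conn_classes (free_arcs G)
    {(s, t). same_colour G s t \<or> (\<exists>e\<in>B. s \<inter> e \<noteq> {} \<and> t \<inter> e \<noteq> {})})"
  unfolding ncolour_def
proof (rule card_conn_classes_quotient[OF free_class_image])
  let ?Q = "{(s, t). same_colour G s t \<or> (\<exists>e\<in>B. s \<inter> e \<noteq> {} \<and> t \<inter> e \<noteq> {})}"
  let ?R = "colour_rel G \<union> merge_rel B"
  have same: "same_colour G (free_class G x) (free_class G y) \<longleftrightarrow> (x, y) \<in> colour_rel G"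
    if "x \<in> points G" "y \<in> points G" for x y
    using free_class_bdry[OF G] that by (auto simp: same_colour_def colour_rel_def)
  fix x y assume x: "x \<in> points G" and y: "y \<in> points G"
  show fib: "(x, y) \<in> conn (points G) ?R"
    if "x \<in> points G" "y \<in> points G" "free_class G x = free_class G y" for x y
  proof -
    obtain C f where C: "C \<in> colours G" "f \<in> C" "x \<in> f"
      using colour_cases[OF G \<open>x \<in> points G\<close>] .
    then have "free_class G y \<subseteq> \<Union>C" using free_class_bdry[OF G that(1) C(1)] that(3) by blast
    then have "(x, y) \<in> colour_rel G" using C free_class_self[of y G] by (auto simp: colour_rel_def)
    then show ?thesis using that(1,2) by (intro conn_step UnI1)
  qed
  show "(free_class G x, free_class G y) \<in> conn (free_arcs G) ?Q" if "(x, y) \<in> ?R"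
  proof (rule conn_step)
    show "(free_class G x, free_class G y) \<in> ?Q"
      using that same[OF x y] free_class_self[of x G] free_class_self[of y G] by (auto simp: merge_rel_def)
  qed (use x y free_class_image[of G] in blast)+
  show "(x, y) \<in> conn (points G) ?R" if Q: "(free_class G x, free_class G y) \<in> ?Q"
  proof (cases "same_colour G (free_class G x) (free_class G y)")
    case True
    then show ?thesis using same[OF x y] x y by (intro conn_step) auto
  next
    case False
    then obtain e a b where e: "e \<in> B" "a \<in> free_class G x" "a \<in> e" "b \<in> free_class G y" "b \<in> e"
      using Q by blast
    note ax = free_classD[OF x e(2)] and yb = free_classD[OF y e(4)]
    have "(a, b) \<in> ?R" using e by (auto simp: merge_rel_def)
    then have "(a, b) \<in> conn (points G) ?R" using ax(1) yb(1) by (rule conn_step)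
    from conn_trans[OF conn_trans[OF fib[OF x ax] this] fib[OF yb(1) y yb(2)[symmetric]]]
    show ?thesis .
  qed
qed

text \<open>The bijection of edges is the image under the corner map \<open>h\<close>. As
  \<open>h\<close> commutes with \<open>corner_step\<close> and is compatible with \<open>k\<close>,
  the map \<open>k\<close> is an isomorphism of the relations on free arcs that compute both
  counts.\<close>

lemma equivalent_counts:
  assumes G: "bcrg G" and H: "bcrg H" and GH: "equivalent G H"
  obtains \<phi> where "bij_betw \<phi> (edges G) (edges H)"
    "\<And>A. A \<subseteq> edges G \<Longrightarrow> nbdry H (\<phi> ` A) = nbdry G A"
    "\<And>B. B \<subseteq> edges G \<Longrightarrow> ncolour H (\<phi> ` B) = ncolour G B"
proof -
  let ?E = "\<Union>(edges G)" and ?F = "\<Union>(edges H)"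
  obtain h k where h: "bij_betw h ?E ?F" and k: "bij_betw k (free_arcs G) (free_arcs H)"
    and loc: "\<forall>p\<in>?E. h (seg G p) = seg H (h p) \<and> h (side G p) = side H (h p) \<and>
      (\<forall>s\<in>free_arcs G. p \<in> s \<longleftrightarrow> h p \<in> k s)"
    and col0: "\<forall>s\<in>free_arcs G. \<forall>t\<in>free_arcs G. same_colour G s t \<longleftrightarrow> same_colour H (k s) (k t)"
    using GH unfolding equivalent_def by (elim exE conjE)
  have hseg: "h (seg G p) = seg H (h p)" and hside: "h (side G p) = side H (h p)" if "p \<in> ?E" for p
    using bspec[OF loc that] by simp_all
  have hk: "p \<in> s \<longleftrightarrow> h p \<in> k s" if "p \<in> ?E" "s \<in> free_arcs G" for p s
    using bspec[OF loc that(1)] that(2) by simp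
  have col: "same_colour G s t \<longleftrightarrow> same_colour H (k s) (k t)"
    if "s \<in> free_arcs G" "t \<in> free_arcs G" for s t
    using bspec[OF bspec[OF col0 that(1)] that(2)] .
  note GD = bcrgD(1)[OF G] and HD = bcrgD(1)[OF H]
  note inj = bij_betw_imp_inj_on[OF h]
  have hF: "h p \<in> ?F" if "p \<in> ?E" for p using bij_betwE[OF h] that by blast
  have cyc: "e = {p, seg G p, side G p, seg G (side G p)}" if "ribbon_graph G" "e \<in> edges G" "p \<in> e"
    for e p and G :: "'a bcrg"
    using four_cycle[OF ribbon_graph_edgeD(3,4,5,2)[OF that(1,2)] that(3)] .
  have edge: "h ` e \<in> edges H" if e: "e \<in> edges G" for e
  proof -
    have "e \<noteq> {}" using ribbon_graph_edgeD(2)[OF GD e] by auto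
    then obtain p where p: "p \<in> e" by blast
    note eq = cyc[OF GD e p]
    have pE: "p \<in> ?E" and sE: "side G p \<in> ?E" using p e eq by blast+
    obtain e' where e': "e' \<in> edges H" "h p \<in> e'" using hF[OF pE] by blast
    \<comment> \<open>An edge is the 4-cycle generated from any of its corners by \<open>seg\<close>
      and \<open>side\<close>, and \<open>h\<close> respects both maps.\<close>
    have "h ` e = {h p, seg H (h p), side H (h p), seg H (side H (h p))}"
      by (subst eq) (simp add: hseg[OF pE] hside[OF pE] hseg[OF sE])
    also have "\<dots> = e'" using cyc[OF HD e'] by simp
    finally show ?thesis using e'(1) by simp
  qed
  have "bij_betw ((`) h) (edges G) (edges H)"
  proof (rule bij_betw_imageI)
    show "inj_on ((`) h) (edges G)"
    proof (rule inj_onI)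
      fix e f assume "e \<in> edges G" "f \<in> edges G" "h ` e = h ` f"
      then show "e = f" using inj_on_image_eq_iff[OF inj, of e f] by blast
    qed
    have "e' \<in> (`) h ` edges G" if e': "e' \<in> edges H" for e'
    proof -
      have "e' \<noteq> {}" using ribbon_graph_edgeD(2)[OF HD e'] by auto
      then obtain p' where p': "p' \<in> e'" by blast
      then have "p' \<in> h ` ?E" using e' bij_betw_imp_surj_on[OF h] by blast
      then obtain p e where p: "p' = h p" "p \<in> e" "e \<in> edges G" by blast
      then have "p' \<in> h ` e" by blast
      then have "h ` e = e'" using ribbon_graph_edge_unique[OF HD edge[OF p(3)] e'] p' by blast
      then show ?thesis using p(3) by blast
    qed
    then show "(`) h ` edges G = edges H" using edge by blast
  qed
  moreover have "nbdry H ((`) h ` A) = nbdry G A" if A: "A \<subseteq> edges G" for A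
  proof -
    have memA: "h p \<in> \<Union>((`) h ` A) \<longleftrightarrow> p \<in> \<Union>A" if p: "p \<in> ?E" for p
    proof
      assume "h p \<in> \<Union>((`) h ` A)"
      then obtain e where e: "e \<in> A" "h p \<in> h ` e" by blast
      then have "e \<subseteq> ?E" using A by blast
      then have "p \<in> e" using inj_on_image_mem_iff[OF inj p] e(2) by blast
      then show "p \<in> \<Union>A" using e(1) by blast
    qed blast
    have step: "h (corner_step G A p) = corner_step H ((`) h ` A) (h p)" if "p \<in> ?E" for p
      unfolding corner_step_def memA[OF that] using hseg[OF that] hside[OF that] by simp
    have hA: "(`) h ` A \<subseteq> edges H" using edge A by blast
    have "nbdry G A = nbdry H ((`) h ` A)"
      unfolding nbdry_free_arcs[OF GD A] nbdry_free_arcs[OF HD hA]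
    proof (rule card_conn_classes_iso[OF k])
      fix s t assume st: "s \<in> free_arcs G" "t \<in> free_arcs G"
      have "p \<in> s \<and> corner_step G A p \<in> t \<longleftrightarrow> h p \<in> k s \<and> corner_step H ((`) h ` A) (h p) \<in> k t"
        if p: "p \<in> ?E" for p
        using hk[OF p st(1)] hk[OF corner_step_in[OF GD p] st(2)] step[OF p] by simp
      then have "(\<exists>p\<in>?E. p \<in> s \<and> corner_step G A p \<in> t) \<longleftrightarrow>
        (\<exists>p\<in>h ` ?E. p \<in> k s \<and> corner_step H ((`) h ` A) p \<in> k t)"
        by (simp del: Union_iff)
      then show "(s, t) \<in> {(s, t). \<exists>p\<in>?E. p \<in> s \<and> corner_step G A p \<in> t} \<longleftrightarrow>
        (k s, k t) \<in> {(s, t). \<exists>p\<in>?F. p \<in> s \<and> corner_step H ((`) h ` A) p \<in> t}"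
        unfolding bij_betw_imp_surj_on[OF h] by simp
    qed
    then show ?thesis ..
  qed
  moreover have "ncolour H ((`) h ` B) = ncolour G B" if B: "B \<subseteq> edges G" for B
  proof -
    have "ncolour G B = ncolour H ((`) h ` B)"
      unfolding ncolour_free_arcs[OF G] ncolour_free_arcs[OF H]
    proof (rule card_conn_classes_iso[OF k])
      fix s t assume st: "s \<in> free_arcs G" "t \<in> free_arcs G"
      have "s \<inter> e \<noteq> {} \<longleftrightarrow> k s \<inter> h ` e \<noteq> {}" if e: "e \<in> B" and s: "s \<in> free_arcs G" for e s
      proof -
        have "p \<in> s \<longleftrightarrow> h p \<in> k s" if "p \<in> e" for p using hk[OF _ s] that e B by blast
        then show ?thesis by blast
      qed
      then show "(s, t) \<in> {(s, t). same_colour G s t \<or> (\<exists>e\<in>B. s \<inter> e \<noteq> {} \<and> t \<inter> e \<noteq> {})} \<longleftrightarrow>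
        (k s, k t) \<in> {(s, t). same_colour H s t \<or> (\<exists>e\<in>(`) h ` B. s \<inter> e \<noteq> {} \<and> t \<inter> e \<noteq> {})}"
        using col[OF st] st by simp
    qed
    then show ?thesis ..
  qed
  ultimately show ?thesis by (rule that)
qed

section \<open>The state sum\<close>

lemma lookup_mpow [simp]: "Poly_Mapping.lookup (mpow q m) v = q * Poly_Mapping.lookup m v"
  by (simp add: mpow_def Poly_Mapping.map.rep_eq when_def)

lemma lookup_var [simp]: "Poly_Mapping.lookup (var v) w = (if v = w then 1 else 0)"
  by (simp add: var_def lookup_single when_def)

lemma of_monomial_mult: "of_monomial m * of_monomial n = of_monomial (m + n)"
  by (simp add: of_monomial_def mult_single)

lemma vpow_power: "vpow v 1 ^ n = vpow v (of_nat n)"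
proof (induction n)
  case 0
  have "mpow 0 (var v) = 0" by (rule poly_mapping_eqI) simp
  then show ?case by (simp add: vpow_def of_monomial_def)
next
  case (Suc n)
  have "mpow 1 (var v) + mpow (of_nat n) (var v) = mpow (of_nat (Suc n)) (var v)"
    by (rule poly_mapping_eqI) (simp add: lookup_add algebra_simps)
  then show ?case using Suc by (simp add: vpow_def of_monomial_mult)
qed

lemma coeff_ring_add: "p \<in> coeff_ring \<Longrightarrow> q \<in> coeff_ring \<Longrightarrow> p + q \<in> coeff_ring"
  using Poly_Mapping.keys_add[of p q] unfolding coeff_ring_def by blast

lemma coeff_ring_mult:
  assumes "p \<in> coeff_ring" "q \<in> coeff_ring"
  shows "p * q \<in> coeff_ring"
  unfolding coeff_ring_def
proof (intro CollectI ballI)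
  fix m assume "m \<in> Poly_Mapping.keys (p * q)"
  then obtain a b where ab: "m = a + b" "a \<in> Poly_Mapping.keys p" "b \<in> Poly_Mapping.keys q"
    using keys_mult[of p q] by blast
  have a: "0 \<le> Poly_Mapping.lookup a v \<and> (if v \<in> {Beta, Gamma, A_olc, B_olc} then Poly_Mapping.lookup a v \<in> \<int>
      else 2 * Poly_Mapping.lookup a v \<in> \<int>)" for v
    using assms(1) ab(2) unfolding coeff_ring_def by blast
  have b: "0 \<le> Poly_Mapping.lookup b v \<and> (if v \<in> {Beta, Gamma, A_olc, B_olc} then Poly_Mapping.lookup b v \<in> \<int>
      else 2 * Poly_Mapping.lookup b v \<in> \<int>)" for v
    using assms(2) ab(3) unfolding coeff_ring_def by blast
  show "\<forall>v. 0 \<le> Poly_Mapping.lookup m v \<and> (if v \<in> {Beta, Gamma, A_olc, B_olc} then Poly_Mapping.lookup m v \<in> \<int>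
      else 2 * Poly_Mapping.lookup m v \<in> \<int>)"
  proof
    fix v
    show "0 \<le> Poly_Mapping.lookup m v \<and> (if v \<in> {Beta, Gamma, A_olc, B_olc} then Poly_Mapping.lookup m v \<in> \<int>
      else 2 * Poly_Mapping.lookup m v \<in> \<int>)"
      using a[of v] b[of v] unfolding ab(1) lookup_add
      by (auto simp: distrib_left split: if_splits)
  qed
qed

lemma coeff_ring_vpow:
  assumes "0 \<le> q" "q \<in> \<int> \<or> v \<notin> {Beta, Gamma, A_olc, B_olc} \<and> 2 * q \<in> \<int>"
  shows "vpow v q \<in> coeff_ring"
proof -
  have "2 * q \<in> \<int>" using assms(2) by auto
  then show ?thesis using assms by (auto simp: coeff_ring_def vpow_def of_monomial_def)
qed

lemma coeff_ring_coeffs: "a_coeff t \<in> coeff_ring" "b_coeff t \<in> coeff_ring"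
  by (cases t; simp; intro coeff_ring_mult coeff_ring_vpow; simp)+

text \<open>Exponent vectors of the coefficients, which allow the recursion to be checked one
  indeterminate at a time.\<close>

fun a_mono :: "etype \<Rightarrow> monomial" where
  "a_mono Type_b = mpow 1 (var A_b)"
| "a_mono Type_olc = mpow 1 (var A_olc)"
| "a_mono Type_olh = mpow 1 (var A_olh)"
| "a_mono Type_nl = mpow (1/2) (var A_b) + mpow (1/2) (var A_olh)"

fun b_mono :: "etype \<Rightarrow> monomial" where
  "b_mono Type_b = mpow 1 (var B_b)"
| "b_mono Type_olc = mpow 1 (var B_olc)"
| "b_mono Type_olh = mpow 1 (var B_olh)"
| "b_mono Type_nl = mpow (1/2) (var B_b) + mpow (1/2) (var B_olh)"

lemma a_coeff_mono: "a_coeff t = of_monomial (a_mono t)"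
  by (cases t) (simp_all add: vpow_def of_monomial_mult)

lemma b_coeff_mono: "b_coeff t = of_monomial (b_mono t)"
  by (cases t) (simp_all add: vpow_def of_monomial_mult)

section \<open>Rank functions and state monomials\<close>

lemma rho_eq: "rho G A = (of_nat (card A) + of_nat (nbdry G {}) - of_nat (nbdry G A)) / 2"
  by (simp add: rho_def card_verts card_bdry_update)

lemma mrank_colour_graph:
  assumes "bcrg G" "B \<subseteq> edges G"
  shows "mrank (colour_graph G) B = of_nat (ncolour G {}) - of_nat (ncolour G B)"
  using card_mcomponents[OF assms] card_colours[OF assms(1)]
  by (simp add: mrank_def colour_graph_def)

lemma r3_eq:
  assumes "bcrg G" "A \<subseteq> edges G"
  shows "r3 G A = of_nat (ncolour G (edges G - A)) - of_nat (ncolour G (edges G))"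
  using assms by (simp add: r3_def mrank_colour_graph)

text \<open>\<open>rho\<close>, \<open>r3\<close> and \<open>r4\<close> add up to
  \<open>card A\<close>: each edge contributes 1 in total, and its type decides how this 1 is
  distributed.\<close>

lemma r4_eq:
  assumes "bcrg G" "A \<subseteq> edges G"
  shows "r4 G A = of_nat (card A) - rho G A - r3 G A"
  using assms by (simp add: r4_def r3_def)

text \<open>The summand of \<open>A\<close> in the closed formula after collecting powers. Besides
  the powers of \<open>Beta\<close> and \<open>Gamma\<close>, each rank function gives the
  \<open>B\<close> exponent by its value at \<open>A\<close> and the \<open>A\<close> exponent by
  what is missing to its value at \<open>edges G\<close>.\<close>

definition state_mono :: "'a bcrg \<Rightarrow> 'a set set \<Rightarrow> monomial" where
  "state_mono G A = mpow (of_nat (ncolour G (edges G - A))) (var Beta) + mpow (of_nat (nbdry G A)) (var Gamma)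
     + mpow (rho G (edges G) - rho G A) (var A_b) + mpow (rho G A) (var B_b)
     + mpow (r3 G (edges G) - r3 G A) (var A_olc) + mpow (r3 G A) (var B_olc)
     + mpow (r4 G (edges G) - r4 G A) (var A_olh) + mpow (r4 G A) (var B_olh)"

definition state_sum :: "'a bcrg \<Rightarrow> gpoly" where
  "state_sum G = (\<Sum>A\<in>Pow (edges G). of_monomial (state_mono G A))"

lemma state_sum_tutte_s:
  assumes G: "bcrg G"
  shows "vpow Beta (of_nat (ncomp (colour_graph G)))
          * vpow Gamma (of_nat (card (verts G)) - rho G (edges G))
          * vpow B_b (rho G (edges G))
          * vpow A_olc (r3 G (edges G))
          * vpow A_olh (r4 G (edges G))
          * tutte_s G (var Gamma + var A_b - var B_b)
                      (var Beta + var Gamma + var B_olc - var A_olc)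
                      (var Gamma + var B_olh - var A_olh) = state_sum G"
  unfolding tutte_s_def state_sum_def sum_distrib_left vpow_def of_monomial_mult
proof (intro sum.cong refl arg_cong[of _ _ of_monomial] poly_mapping_eqI)
  fix A v assume "A \<in> Pow (edges G)"
  then have A: "A \<subseteq> edges G" by simp
  have n: "ncomp (colour_graph G) = ncolour G (edges G)"
    using card_mcomponents[OF G subset_refl] by (simp add: ncomp_def colour_graph_def)
  \<comment> \<open>The collected exponent of \<open>Gamma\<close> is v - rho(A) + r3(A) + r4(A),
    which is v + |A| - 2 rho(A), and this identity turns it into b(A).\<close>
  have gamma: "of_nat (nbdry G A) = of_nat (nbdry G {}) + of_nat (card A) - 2 * rho G A"
    by (simp add: rho_eq field_simps)
  show "Poly_Mapping.lookup (mpow (of_nat (ncomp (colour_graph G))) (var Beta) +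
      mpow (of_nat (card (verts G)) - rho G (edges G)) (var Gamma) +
      mpow (rho G (edges G)) (var B_b) + mpow (r3 G (edges G)) (var A_olc) +
      mpow (r4 G (edges G)) (var A_olh) +
      (mpow (rho G (edges G) - rho G A) (var Gamma + var A_b - var B_b) +
       mpow (r3 G A) (var Beta + var Gamma + var B_olc - var A_olc) +
       mpow (r4 G A) (var Gamma + var B_olh - var A_olh))) v
    = Poly_Mapping.lookup (state_mono G A) v"
    using r3_eq[OF G A] r4_eq[OF G A] gamma
    by (cases v) (simp_all add: state_mono_def lookup_add lookup_minus n card_verts)
qed

section \<open>The deletion-contraction recursion\<close>

text \<open>Deletion leaves the ranks of \<open>A\<close> unchanged and lowers the total ranks (rho,
  r3, r4) by (1,0,0), (0,1,0), (0,0,1) or (1/2,0,1/2) for \<open>i\<close> equal to b, olc, olh or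
  nl. This is the exponent vector of \<open>a_mono i\<close>.\<close>

lemma state_mono_delete:
  assumes M: "minor_closed \<G>" and G: "G \<in> \<G>" and e: "e \<in> edges G" and t: "edge_type G e i j"
    and A: "A \<subseteq> edges G - {e}"
  shows "state_mono G A = a_mono i + state_mono (delete G e) A"
proof -
  let ?H = "delete G e" and ?E = "edges G - {e}"
  note bG = minor_closedD(1)[OF M G] and bH = minor_closedD(1)[OF M minor_closedD(3)[OF M G e]]
  have "finite (edges G)" using finite_edges[OF bcrgD(1)[OF bG]] .
  then have cE: "card (edges G) = Suc (card ?E)" using e by (metis card.remove)
  have sets: "insert e (?E - A) = edges G - A" "insert e ?E = edges G" "A \<subseteq> edges G" "A \<subseteq> edges ?H"
    using e A by auto
  define ti tm where "ti = (of_int (type_excess i) :: rat)" and "tm = (of_int (type_merge i) :: rat)"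
  have "of_int (int (nbdry G ?E) - int (nbdry G (edges G))) = ti"
    "of_int (int (ncolour G {}) - int (ncolour G {e})) = tm"
    using edge_type_counts[OF M G e t] by (simp_all only: ti_def tm_def)
  then have ti: "of_nat (nbdry G ?E) - of_nat (nbdry G (edges G)) = ti"
    and tm: "of_nat (ncolour G {}) - of_nat (ncolour G {e}) = tm" by simp_all
  have rho: "rho ?H A = rho G A" "rho G (edges G) = (1 + ti) / 2 + rho ?H ?E"
    using ti by (simp_all add: rho_eq nbdry_delete cE field_simps)
  have r3: "r3 ?H A = r3 G A" "r3 G (edges G) = tm + r3 ?H ?E"
    using tm r3_eq[OF bG sets(3)] r3_eq[OF bG subset_refl] r3_eq[OF bH sets(4)] r3_eq[OF bH subset_refl]
      ncolour_delete[OF bG e] by (simp_all add: sets insert_absorb[OF e])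
  have r4: "r4 ?H A = r4 G A" "r4 G (edges G) = 1 - (1 + ti) / 2 - tm + r4 ?H ?E"
    using r4_eq[OF bG sets(3)] r4_eq[OF bG subset_refl] r4_eq[OF bH sets(4)] r4_eq[OF bH subset_refl]
    by (simp_all add: rho r3 cE)
  show ?thesis
  proof (rule poly_mapping_eqI)
    fix v
    show "Poly_Mapping.lookup (state_mono G A) v = Poly_Mapping.lookup (a_mono i + state_mono ?H A) v"
      by (cases v; cases i)
        (simp_all add: state_mono_def lookup_add nbdry_delete ncolour_delete[OF bG e] sets rho r3 r4 ti_def tm_def)
  qed
qed

text \<open>Contraction lowers the ranks of \<open>insert e A\<close> and the total ranks by the
  same amounts, given by \<open>j\<close>. The differences, and with them the \<open>A\<close>
  exponents, are unchanged, while the \<open>B\<close> exponents drop by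
  \<open>b_mono j\<close>.\<close>

lemma state_mono_contract:
  assumes M: "minor_closed \<G>" and G: "G \<in> \<G>" and e: "e \<in> edges G" and t: "edge_type G e i j"
    and A: "A \<subseteq> edges G - {e}"
  shows "state_mono G (insert e A) = b_mono j + state_mono (contract G e) A"
proof -
  let ?H = "contract G e" and ?E = "edges G - {e}" and ?A = "insert e A"
  note bG = minor_closedD(1)[OF M G] and bH = minor_closedD(1)[OF M minor_closedD(4)[OF M G e]]
  have fin: "finite (edges G)" using finite_edges[OF bcrgD(1)[OF bG]] .
  then have cE: "card (edges G) = Suc (card ?E)" using e by (metis card.remove)
  have "finite A" using fin A by (meson finite_Diff finite_subset)
  then have cA: "card ?A = Suc (card A)" using A by (subst card_insert_disjoint) auto
  have sets: "?E - A = edges G - ?A" "insert e ?E = edges G" "?A \<subseteq> edges G" "A \<subseteq> edges ?H"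
    using e A by auto
  define tj tm where "tj = (of_int (type_excess j) :: rat)" and "tm = (of_int (type_merge j) :: rat)"
  have "of_int (int (nbdry G {}) - int (nbdry G {e})) = tj"
    "of_int (int (ncolour G ?E) - int (ncolour G (edges G))) = tm"
    using edge_type_counts[OF M G e t] by (simp_all only: tj_def tm_def)
  then have tj: "of_nat (nbdry G {}) - of_nat (nbdry G {e}) = tj"
    and tm: "of_nat (ncolour G ?E) - of_nat (ncolour G (edges G)) = tm" by simp_all
  have rho: "rho G ?A = (1 + tj) / 2 + rho ?H A" "rho G (edges G) = (1 + tj) / 2 + rho ?H ?E"
    using tj by (simp_all add: rho_eq nbdry_contract cE cA sets insert_absorb[OF e] field_simps)
  have r3: "r3 G ?A = tm + r3 ?H A" "r3 G (edges G) = tm + r3 ?H ?E"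
    using tm r3_eq[OF bG sets(3)] r3_eq[OF bG subset_refl] r3_eq[OF bH sets(4)] r3_eq[OF bH subset_refl]
    by (simp_all add: sets ncolour_contract)
  have r4: "r4 G ?A = 1 - (1 + tj) / 2 - tm + r4 ?H A" "r4 G (edges G) = 1 - (1 + tj) / 2 - tm + r4 ?H ?E"
    using r4_eq[OF bG sets(3)] r4_eq[OF bG subset_refl] r4_eq[OF bH sets(4)] r4_eq[OF bH subset_refl]
    by (simp_all add: rho r3 cE cA)
  show ?thesis
  proof (rule poly_mapping_eqI)
    fix v
    show "Poly_Mapping.lookup (state_mono G ?A) v = Poly_Mapping.lookup (b_mono j + state_mono ?H A) v"
      by (cases v; cases j)
        (simp_all add: state_mono_def lookup_add nbdry_contract ncolour_contract sets rho r3 r4 tj_def tm_def)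
  qed
qed

lemma state_sum_deletion_contraction:
  assumes M: "minor_closed \<G>" and G: "G \<in> \<G>" and e: "e \<in> edges G" and t: "edge_type G e i j"
  shows "state_sum G = a_coeff i * state_sum (delete G e) + b_coeff j * state_sum (contract G e)"
proof -
  let ?P = "Pow (edges G - {e})"
  have fin: "finite (edges G)"
    using finite_edges[OF bcrgD(1)[OF minor_closedD(1)[OF M G]]] .
  have "edges G = insert e (edges G - {e})" using e by blast
  then have "Pow (edges G) = ?P \<union> insert e ` ?P" using Pow_insert by metis
  then have "state_sum G = (\<Sum>A\<in>?P \<union> insert e ` ?P. of_monomial (state_mono G A))"
    by (simp add: state_sum_def)
  also have "\<dots> = (\<Sum>A\<in>?P. of_monomial (state_mono G A)) + (\<Sum>A\<in>insert e ` ?P. of_monomial (state_mono G A))"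
    by (rule sum.union_disjoint) (use fin in auto)
  also have "(\<Sum>A\<in>insert e ` ?P. of_monomial (state_mono G A)) = (\<Sum>A\<in>?P. of_monomial (state_mono G (insert e A)))"
    by (rule sum.reindex_cong[of "insert e"]) (auto simp: inj_on_def)
  also have "(\<Sum>A\<in>?P. of_monomial (state_mono G A)) = a_coeff i * state_sum (delete G e)"
    unfolding state_sum_def sum_distrib_left a_coeff_mono of_monomial_mult delete_simps
    by (intro sum.cong refl arg_cong[of _ _ of_monomial] state_mono_delete[OF M G e t]) simp
  also have "(\<Sum>A\<in>?P. of_monomial (state_mono G (insert e A))) = b_coeff j * state_sum (contract G e)"
    unfolding state_sum_def sum_distrib_left b_coeff_mono of_monomial_mult contract_simps
    by (intro sum.cong refl arg_cong[of _ _ of_monomial] state_mono_contract[OF M G e t]) simp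
  finally show ?thesis .
qed

lemma state_sum_edgeless:
  assumes G: "bcrg G" and "edges G = {}"
  shows "state_sum G = vpow Beta 1 ^ card (colours G) * vpow Gamma 1 ^ card (verts G)"
proof -
  have "state_mono G {} = mpow (of_nat (ncolour G {})) (var Beta) + mpow (of_nat (nbdry G {})) (var Gamma)"
  proof (rule poly_mapping_eqI)
    fix v
    show "Poly_Mapping.lookup (state_mono G {}) v = Poly_Mapping.lookup
      (mpow (of_nat (ncolour G {})) (var Beta) + mpow (of_nat (nbdry G {})) (var Gamma)) v"
      using r3_eq[OF G, of "{}"] r4_eq[OF G, of "{}"] assms(2)
      by (cases v) (simp_all add: state_mono_def lookup_add rho_eq)
  qed
  then show ?thesis
    by (simp add: state_sum_def assms(2) vpow_power card_colours[OF G] card_verts)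
      (simp add: vpow_def of_monomial_mult)
qed

text \<open>Every exponent is built from \<open>nbdry\<close>, \<open>ncolour\<close> and
  cardinalities, all preserved by the bijection of edges, along which the sum is reindexed.\<close>

lemma state_sum_equivalent:
  assumes G: "bcrg G" and H: "bcrg H" and GH: "equivalent G H"
  shows "state_sum G = state_sum H"
proof -
  obtain \<phi> where \<phi>: "bij_betw \<phi> (edges G) (edges H)"
    and nb: "\<And>A. A \<subseteq> edges G \<Longrightarrow> nbdry H (\<phi> ` A) = nbdry G A"
    and nc: "\<And>B. B \<subseteq> edges G \<Longrightarrow> ncolour H (\<phi> ` B) = ncolour G B"
    using equivalent_counts[OF G H GH] by blast
  note inj = bij_betw_imp_inj_on[OF \<phi>] and surj = bij_betw_imp_surj_on[OF \<phi>]
  have rho: "rho H (\<phi> ` A) = rho G A" if "A \<subseteq> edges G" for A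
    using nb[OF that] nb[of "{}"] card_image[OF inj_on_subset[OF inj that]] by (simp add: rho_eq)
  have diff: "edges H - \<phi> ` A = \<phi> ` (edges G - A)" if "A \<subseteq> edges G" for A
    using inj_on_image_set_diff[OF inj _ that, of "edges G"] surj by simp
  have r3: "r3 H (\<phi> ` A) = r3 G A" if A: "A \<subseteq> edges G" for A
  proof -
    have "\<phi> ` A \<subseteq> edges H" using A surj by blast
    then show ?thesis
      using r3_eq[OF G A] r3_eq[OF H] nc[of "edges G - A"] nc[of "edges G"] by (simp add: diff[OF A] surj)
  qed
  have r4: "r4 H (\<phi> ` A) = r4 G A" if A: "A \<subseteq> edges G" for A
  proof -
    have "\<phi> ` A \<subseteq> edges H" using A surj by blast
    then show ?thesis
      using r4_eq[OF G A] r4_eq[OF H] card_image[OF inj_on_subset[OF inj A]] by (simp add: rho[OF A] r3[OF A])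
  qed
  have mono: "state_mono H (\<phi> ` A) = state_mono G A" if A: "A \<subseteq> edges G" for A
    using rho[OF A] rho[OF subset_refl] r3[OF A] r3[OF subset_refl] r4[OF A] r4[OF subset_refl]
      nb[OF A] nc[of "edges G - A"]
    by (simp add: state_mono_def diff[OF A] surj)
  have "state_sum H = (\<Sum>A\<in>Pow (edges G). of_monomial (state_mono H (\<phi> ` A)))"
    unfolding state_sum_def by (rule sum.reindex_bij_betw[OF bij_betw_Pow[OF \<phi>], symmetric])
  also have "\<dots> = state_sum G" unfolding state_sum_def by (rule sum.cong) (simp_all add: mono)
  finally show ?thesis ..
qed

section \<open>Existence and uniqueness\<close>

lemma minor_induct [consumes 2, case_names edgeless edge]:
  assumes M: "minor_closed \<G>" and G: "G \<in> \<G>"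
    and "\<And>G. G \<in> \<G> \<Longrightarrow> edges G = {} \<Longrightarrow> P G"
    and step: "\<And>G e. G \<in> \<G> \<Longrightarrow> e \<in> edges G \<Longrightarrow> P (delete G e) \<Longrightarrow> P (contract G e) \<Longrightarrow> P G"
  shows "P G"
  using G
proof (induction "card (edges G)" arbitrary: G rule: less_induct)
  case less
  show ?case
  proof (cases "edges G = {}")
    case False
    then obtain e where e: "e \<in> edges G" by blast
    have "finite (edges G)"
      using finite_edges[OF bcrgD(1)[OF minor_closedD(1)[OF M less.prems]]] .
    then have "card (edges G - {e}) < card (edges G)" using e by (rule card_Diff1_less)
    then show ?thesis
      using less.hyps[of "delete G e"] less.hyps[of "contract G e"] minor_closedD(3,4)[OF M less.prems e]
      by (intro step[OF less.prems e]) simp_all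
  qed (use less.prems assms(3) in blast)
qed

text \<open>That no exponent is negative or has a wrong denominator is not read off the rank
  functions: it follows by induction from the recursion, whose coefficients and initial values lie
  in the ring.\<close>

lemma state_sum_coeff_ring:
  assumes M: "minor_closed \<G>" and "G \<in> \<G>"
  shows "state_sum G \<in> coeff_ring"
  using assms
proof (induction rule: minor_induct)
  case (edgeless G)
  then show ?case
    using state_sum_edgeless[OF minor_closedD(1)[OF M]]
    by (simp add: vpow_power coeff_ring_mult coeff_ring_vpow)
next
  case (edge G e)
  obtain i j where "edge_type G e i j" using edge_type_exists[OF M edge.hyps] by blast
  from state_sum_deletion_contraction[OF M edge.hyps this] edge.IH show ?case
    by (simp add: coeff_ring_add coeff_ring_mult coeff_ring_coeffs)
qed

lemma deletion_contraction_map_state_sum: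
  assumes M: "minor_closed \<G>"
  shows "deletion_contraction_map \<G> (restrict state_sum \<G>)"
  unfolding deletion_contraction_map_def
proof (intro conjI ballI allI impI)
  show "restrict state_sum \<G> \<in> \<G> \<rightarrow>\<^sub>E coeff_ring" using state_sum_coeff_ring[OF M] by simp
next
  fix G H assume "G \<in> \<G>" "H \<in> \<G>" "equivalent G H"
  then show "restrict state_sum \<G> G = restrict state_sum \<G> H"
    using state_sum_equivalent[of G H] minor_closedD(1)[OF M] by simp
next
  fix G e i j assume "G \<in> \<G>" "e \<in> edges G" "edge_type G e i j"
  then show "restrict state_sum \<G> G
    = a_coeff i * restrict state_sum \<G> (delete G e) + b_coeff j * restrict state_sum \<G> (contract G e)"
    using state_sum_deletion_contraction[OF M] minor_closedD(3,4)[OF M] by simp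
next
  fix G assume "G \<in> \<G>" "edges G = {}"
  then show "restrict state_sum \<G> G = vpow Beta 1 ^ card (colours G) * vpow Gamma 1 ^ card (verts G)"
    using state_sum_edgeless[OF minor_closedD(1)[OF M]] by simp
qed

text \<open>Every edge has a type, so the recursion applies to any edge and determines U on the
  class from the edgeless graphs; outside the class U is fixed by extensionality.\<close>

lemma deletion_contraction_map_unique:
  assumes M: "minor_closed \<G>" and U: "deletion_contraction_map \<G> U"
  shows "U = restrict state_sum \<G>"
proof (rule extensionalityI[of _ \<G>])
  show "U \<in> extensional \<G>" using U by (auto simp: deletion_contraction_map_def PiE_def)
  fix G assume "G \<in> \<G>"
  with M have "U G = state_sum G"
  proof (induction rule: minor_induct)
    case (edgeless G)
    then show ?case
      using U state_sum_edgeless[OF minor_closedD(1)[OF M edgeless(1)]] by (simp add: deletion_contraction_map_def)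
  next
    case (edge G e)
    obtain i j where t: "edge_type G e i j" using edge_type_exists[OF M edge.hyps] by blast
    then have "U G = a_coeff i * U (delete G e) + b_coeff j * U (contract G e)"
      using U edge.hyps unfolding deletion_contraction_map_def by blast
    then show ?case using state_sum_deletion_contraction[OF M edge.hyps t] edge.IH by simp
  qed
  then show "U G = restrict state_sum \<G> G" using \<open>G \<in> \<G>\<close> by simp
qed simp

theorem theorem4p5:
  fixes \<G> :: "'a bcrg set"
  assumes "minor_closed \<G>"
  shows "(\<exists>!U. deletion_contraction_map \<G> U) \<and>
    (\<forall>U. deletion_contraction_map \<G> U \<longrightarrow> (\<forall>G\<in>\<G>.
      U G = vpow Beta (of_nat (ncomp (colour_graph G)))
          * vpow Gamma (of_nat (card (verts G)) - rho G (edges G))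
          * vpow B_b (rho G (edges G))
          * vpow A_olc (r3 G (edges G))
          * vpow A_olh (r4 G (edges G))
          * tutte_s G (var Gamma + var A_b - var B_b)
                      (var Beta + var Gamma + var B_olc - var A_olc)
                      (var Gamma + var B_olh - var A_olh)))"
proof (intro conjI allI impI ballI)
  show "\<exists>!U. deletion_contraction_map \<G> U"
    using deletion_contraction_map_state_sum[OF assms] deletion_contraction_map_unique[OF assms] by blast
next
  fix U G assume U: "deletion_contraction_map \<G> U" and G: "G \<in> \<G>"
  have "U G = state_sum G" using deletion_contraction_map_unique[OF assms U] G by simp
  then show "U G = vpow Beta (of_nat (ncomp (colour_graph G)))
          * vpow Gamma (of_nat (card (verts G)) - rho G (edges G))
          * vpow B_b (rho G (edges G))
          * vpow A_olc (r3 G (edges G))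
          * vpow A_olh (r4 G (edges G))
          * tutte_s G (var Gamma + var A_b - var B_b)
                      (var Beta + var Gamma + var B_olc - var A_olc)
                      (var Gamma + var B_olh - var A_olh)"
    using state_sum_tutte_s[OF minor_closedD(1)[OF assms G]] by simp
qed

end
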